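(* We have the following equality of bigraded subspaces of $\mathfrak{Lie}(B)$: \[ \mathfrak{stab}_{\mathfrak{Lie}(B)}(\tau)=\mathfrak{lq}\oplus\mathbb{Q}b_0 . \]
   Context: Let $B=\{b_0,b_1,b_2,\dots\}$, let $\mathbb{Q}\langle B\rangle$ be the free associative $\mathbb{Q}$-algebra on $B$ with coproduct $\Delta_B$ the algebra morphism with $\Delta_B(b_i)=b_i\otimes1+1\otimes b_i$, and let $\mathfrak{Lie}(B)$ be the free Lie algebra on $B$, identified with the $\Delta_B$-primitive elements. $\mathfrak{Lie}(B)$ is bigraded by weight and depth with $b_0$ of bidegree $(1,0)$ and $b_i$ of bidegree $(i,1)$ for $i\ge1$. Let $\mathbb{Q}\langle B\rangle^0$ be the span of words not ending in $b_0$ (a subalgebra, freely generated by the $b_0^mb_k$, $m\ge0,k\ge1$), and $\pi_0:\mathbb{Q}\langle B\rangle\to\mathbb{Q}\langle B\rangle^0$ the projection along $\mathbb{Q}\langle B\rangle b_0$ (it kills words ending in $b_0$ and fixes all other words). For a word $w=b_0^{m_1}b_{k_1}\cdots b_0^{m_d}b_{k_d}b_0^{m_{d+1}}$ ($d\ge1$, $k_i\ge1$, $m_i\ge0$), write $\mathbf{k}=(k_1,\dots,k_d)$ and for $\mathbf{l}=(l_1,\dots,l_d)\in\mathbb{Z}_{>0}^d$ set $w(\mathbf{l})=b_0^{m_1}b_{l_1}\cdots b_0^{m_d}b_{l_d}b_0^{m_{d+1}}$, $|\mathbf{k}|=\sum k_i$, $\binom{\mathbf{k}-1}{\mathbf{l}-1}=\prod_i\binom{k_i-1}{l_i-1}$,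 and $\mathbf{l}\le\mathbf{k}$ iff $l_i\le k_i$ for all $i$. Let $\partial_w$ be the derivation of $\mathbb{Q}\langle B\rangle$ with $\partial_w(b_0)=0$ and $\partial_w(b_i)=\sum_{\mathbf{l}\le\mathbf{k}}(-1)^{|\mathbf{k}|+|\mathbf{l}|}\binom{\mathbf{k}-1}{\mathbf{l}-1}[b_{i+|\mathbf{k}|-|\mathbf{l}|},w(\mathbf{l})]$ for $i\ge1$; if $w=b_0^m$ ($m\ge1$), $\partial_w(b_0)=0$ and $\partial_w(b_i)=[b_i,w]$. Extend $\psi\mapsto\partial_\psi$ linearly. The bracket $\{\psi_1,\psi_2\}_A=\partial_{\psi_1}(\psi_2)-\partial_{\psi_2}(\psi_1)+[\psi_1,\psi_2]$ is a Lie bracket on $\mathfrak{Lie}(B)$. For $\psi\in\mathfrak{Lie}(B)$ let $\sigma_\psi=\ell_\psi+\partial_\psi$ ($\ell_\psi$ left multiplication by $\psi$); it maps $\mathbb{Q}\langle B\rangle b_0$ into itself, so there is a unique linear endomorphism $\sigma^0_\psi$ of $\mathbb{Q}\langle B\rangle^0$ with $\pi_0\circ\sigma_\psi=\sigma^0_\psi\circ\pi_0$. Let $\tau$ be the algebra antiautomorphism of $\mathbb{Q}\langle B\rangle^0$ with $\tau(b_0^mb_k)=b_0^{k-1}b_{m+1}$ ($m\ge0,k\ge1$). Define $\mathfrak{stab}_{\mathfrak{Lie}(B)}(\tau)=\{\psi\in\mathfrak{Lie}(B)\mid\sigma^0_\psi\circ\tau=\tau\circ\sigma^0_\psi\}$.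 For a word $w$, $(\psi\mid w)$ is the coefficient of $w$ in $\psi$. Let $\mathfrak{lq}$ be the set of $\psi\in\mathbb{Q}\langle B\rangle$ with (i) $(\psi\mid b_0)=0$; (ii) $\Delta_B(\psi)=\psi\otimes1+1\otimes\psi$; (iii) $\tau(\pi_0(\psi))=\pi_0(\psi)$; (iv) $(\psi\mid b_0^mb_k)=0$ for all $m\ge0,k\ge1$ with $k+m$ even. *)

theory Defs
  imports
    Complex_Main
    "HOL-Library.Poly_Mapping"
    "HOL-Library.Product_Plus"
    "HOL-Library.FuncSet"
begin

section \<open>The free algebra on \<open>B\<close>\<close>

text \<open>
  The letter \<open>b\<^sub>i\<close> is encoded by \<open>i\<close>, a word by a list. With lists as an additive monoid under
  concatenation, the convolution product of \<open>Poly_Mapping\<close> makes \<^typ>\<open>nat list \<Rightarrow>\<^sub>0 rat\<close> the free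
  associative algebra on \<open>B\<close>, and \<^typ>\<open>(nat list \<times> nat list) \<Rightarrow>\<^sub>0 rat\<close> its tensor square. The
  coefficient of \<open>w\<close> in \<open>\<psi>\<close> is \<^term>\<open>Poly_Mapping.lookup \<psi> w\<close>.
\<close>

instantiation list :: (type) monoid_add
begin
definition zero_list :: "'a list" where "zero_list = []"
definition plus_list :: "'a list \<Rightarrow> 'a list \<Rightarrow> 'a list" where "plus_list = (@)"
instance by standard (simp_all add: zero_list_def plus_list_def)
end

type_synonym QB = "nat list \<Rightarrow>\<^sub>0 rat"

definition scale :: "rat \<Rightarrow> ('a::monoid_add \<Rightarrow>\<^sub>0 rat) \<Rightarrow> ('a \<Rightarrow>\<^sub>0 rat)" where
  "scale c x = Poly_Mapping.single 0 c * x"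

lemma lookup_scale [simp]: "Poly_Mapping.lookup (scale c x) w = c * Poly_Mapping.lookup x w"
proof -
  have "scale c x = Poly_Mapping.map ((*) c) x"
    by (simp add: scale_def mult_map_scale_conv_mult)
  then show ?thesis by (simp add: Poly_Mapping.map.rep_eq when_def)
qed

interpretation QV: vector_space "scale :: rat \<Rightarrow> ('a::monoid_add \<Rightarrow>\<^sub>0 rat) \<Rightarrow> ('a \<Rightarrow>\<^sub>0 rat)"
  by standard (auto intro!: poly_mapping_eqI simp: lookup_add algebra_simps)

definition mword :: "nat list \<Rightarrow> QB" where
  "mword w = Poly_Mapping.single w 1"

abbreviation letter :: "nat \<Rightarrow> QB" where
  "letter i \<equiv> mword [i]"

definition lie_bracket :: "QB \<Rightarrow> QB \<Rightarrow> QB" where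
  "lie_bracket x y = x * y - y * x"

definition lin :: "('a \<Rightarrow> ('b::monoid_add \<Rightarrow>\<^sub>0 rat)) \<Rightarrow> ('a \<Rightarrow>\<^sub>0 rat) \<Rightarrow> ('b \<Rightarrow>\<^sub>0 rat)" where
  "lin f x = (\<Sum>w\<in>Poly_Mapping.keys x. scale (Poly_Mapping.lookup x w) (f w))"

lemma lin_superset:
  assumes "finite S" "Poly_Mapping.keys x \<subseteq> S"
  shows "lin f x = (\<Sum>w\<in>S. scale (Poly_Mapping.lookup x w) (f w))"
  unfolding lin_def
  by (rule sum.mono_neutral_left) (use assms in \<open>auto simp: in_keys_iff\<close>)

lemma lin_add: "lin f (x + y) = lin f x + lin f y"
proof -
  let ?S = "Poly_Mapping.keys x \<union> Poly_Mapping.keys y"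
  have "lin f (x + y) = (\<Sum>w\<in>?S. scale (Poly_Mapping.lookup (x + y) w) (f w))"
    by (rule lin_superset) (simp_all add: Poly_Mapping.keys_add)
  also have "\<dots> = (\<Sum>w\<in>?S. scale (Poly_Mapping.lookup x w) (f w)) + (\<Sum>w\<in>?S. scale (Poly_Mapping.lookup y w) (f w))"
    by (simp add: lookup_add QV.scale_left_distrib sum.distrib)
  also have "\<dots> = lin f x + lin f y"
    by (simp add: lin_superset[of ?S])
  finally show ?thesis .
qed

lemma lin_scale: "lin f (scale c x) = scale c (lin f x)"
proof -
  have "lin f (scale c x) = (\<Sum>w\<in>Poly_Mapping.keys x. scale (Poly_Mapping.lookup (scale c x) w) (f w))"
    by (rule lin_superset) (auto simp: in_keys_iff)
  then show ?thesis by (simp add: lin_def QV.scale_sum_right)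
qed

lemma lin_zero [simp]: "lin f 0 = 0"
  by (simp add: lin_def)

lemma lin_single [simp]: "lin f (Poly_Mapping.single w 1) = f w"
  by (simp add: lin_def)

lemma lin_mword [simp]: "lin f (mword w) = f w"
  by (simp add: mword_def)

lemma lin_minus: "lin f (x - y) = lin f x - lin f y"
  using lin_add[of f "x - y" y] by simp

lemma lin_sum: "lin f (sum g A) = (\<Sum>a\<in>A. lin f (g a))"
  by (induction A rule: infinite_finite_induct) (auto simp: lin_add)

lemma pm_induct [case_names scale add]:
  fixes x :: "'a::monoid_add \<Rightarrow>\<^sub>0 rat"
  assumes sc: "\<And>c w. P (scale c (Poly_Mapping.single w 1))"
    and ad: "\<And>x y. P x \<Longrightarrow> P y \<Longrightarrow> P (x + y)"
  shows "P x"
proof -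
  have P0: "P 0" using sc[of 0] by simp
  have "x = (\<Sum>w\<in>Poly_Mapping.keys x. scale (Poly_Mapping.lookup x w) (Poly_Mapping.single w 1))"
    by (rule poly_mapping_eqI)
      (simp add: lookup_sum lookup_single when_def in_keys_iff if_distrib[of "(*) _"] cong: if_cong)
  moreover have "P (\<Sum>w\<in>S. scale (Poly_Mapping.lookup x w) (Poly_Mapping.single w 1))" if "finite S" for S
    using that by (induction S) (auto intro: P0 sc ad)
  ultimately show ?thesis by (metis finite_keys)
qed

lemma QB_induct [case_names scale add]:
  assumes "\<And>c w. P (scale c (mword w))" "\<And>x y. P x \<Longrightarrow> P y \<Longrightarrow> P (x + y)"
  shows "P (x :: QB)"
  by (rule pm_induct) (use assms in \<open>auto simp: mword_def\<close>)

lemma lin_mword_id [simp]: "lin mword x = x"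
  by (induction x rule: QB_induct) (simp_all add: lin_add lin_scale)

lemma scale_mult_left: "scale c x * y = scale c (x * y)"
  by (simp add: scale_def mult.assoc)

lemma single_zero_comm: "Poly_Mapping.single 0 (c::rat) * x = x * Poly_Mapping.single 0 c"
  for x :: "'a::monoid_add \<Rightarrow>\<^sub>0 rat"
proof (induction x rule: pm_induct)
  case (scale d w)
  show ?case by (simp add: Defs.scale_def mult_single mult.commute)
next
  case (add x y)
  then show ?case by (simp add: distrib_left distrib_right)
qed

lemma scale_mult_right: "x * scale c y = scale c (x * y)"
  by (metis mult.assoc scale_def single_zero_comm)

lemma lookup_mword: "Poly_Mapping.lookup (mword w) v = (if v = w then 1 else 0)"
  by (simp add: mword_def lookup_single when_def)

lemma mword_mult: "mword u * mword v = mword (u @ v)"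
  by (simp add: mword_def mult_single plus_list_def)

lemma mword_Nil: "mword [] = 1"
  by (simp add: mword_def zero_list_def[symmetric])

section \<open>Coproduct and the free Lie algebra\<close>

definition tens :: "QB \<Rightarrow> QB \<Rightarrow> ((nat list \<times> nat list) \<Rightarrow>\<^sub>0 rat)" where
  "tens x y = lin (\<lambda>u. lin (\<lambda>v. Poly_Mapping.single (u, v) 1) y) x"

definition coproduct :: "QB \<Rightarrow> ((nat list \<times> nat list) \<Rightarrow>\<^sub>0 rat)" where
  "coproduct = lin (\<lambda>w. prod_list (map (\<lambda>i. tens (letter i) 1 + tens 1 (letter i)) w))"

definition primitive :: "QB \<Rightarrow> bool" where
  "primitive \<psi> \<longleftrightarrow> coproduct \<psi> = tens \<psi> 1 + tens 1 \<psi>"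

text \<open>
  The free Lie algebra on \<open>B\<close>, realised as the Lie subalgebra of the free associative algebra
  generated by \<open>B\<close>; \<open>Lie_B_eq_primitive\<close> below identifies it with the primitive elements.
\<close>

inductive_set Lie_B :: "QB set" where
  letter: "letter i \<in> Lie_B"
| zero: "0 \<in> Lie_B"
| add: "x \<in> Lie_B \<Longrightarrow> y \<in> Lie_B \<Longrightarrow> x + y \<in> Lie_B"
| scale: "x \<in> Lie_B \<Longrightarrow> scale c x \<in> Lie_B"
| bracket: "x \<in> Lie_B \<Longrightarrow> y \<in> Lie_B \<Longrightarrow> lie_bracket x y \<in> Lie_B"

lemma one_eq_single: "(1 :: QB) = Poly_Mapping.single [] 1"
  by (simp add: zero_list_def[symmetric])

lemma tens_one_right: "tens x 1 = lin (\<lambda>u. Poly_Mapping.single (u, []) 1) x"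
  by (simp only: tens_def one_eq_single lin_single)

lemma tens_one_left: "tens 1 x = lin (\<lambda>v. Poly_Mapping.single ([], v) 1) x"
  by (simp only: tens_def one_eq_single lin_single)

lemma pair_mult:
  "Poly_Mapping.single (u, v) (1::rat) * Poly_Mapping.single (u', v') 1
    = Poly_Mapping.single (u @ u', v @ v' :: nat list) 1"
  by (simp add: mult_single plus_list_def)

lemma single_pair_one: "Poly_Mapping.single ([] :: nat list, [] :: nat list) (1::rat) = 1"
  by (metis single_one zero_list_def zero_prod_def)

lemma tens_one_right_mult: "tens (x * y) 1 = tens x 1 * tens y 1"
proof (induction x rule: QB_induct)
  case (scale c u)
  show ?case
  proof (induction y rule: QB_induct)
    case (scale d v)
    show ?case
      by (simp add: tens_one_right scale_mult_left scale_mult_right lin_scale mword_mult pair_mult)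
  next
    case (add x y)
    then show ?case by (simp add: tens_one_right lin_add distrib_left)
  qed
next
  case (add x y)
  then show ?case by (simp add: tens_one_right lin_add distrib_right)
qed

lemma tens_one_left_mult: "tens 1 (x * y) = tens 1 x * tens 1 y"
proof (induction x rule: QB_induct)
  case (scale c u)
  show ?case
  proof (induction y rule: QB_induct)
    case (scale d v)
    show ?case
      by (simp add: tens_one_left scale_mult_left scale_mult_right lin_scale mword_mult pair_mult)
  next
    case (add x y)
    then show ?case by (simp add: tens_one_left lin_add distrib_left)
  qed
next
  case (add x y)
  then show ?case by (simp add: tens_one_left lin_add distrib_right)
qed

lemma tens_one_commute: "tens x 1 * tens 1 y = tens 1 y * tens x 1"
proof (induction x rule: QB_induct)
  case (scale c u)
  show ?case
  proof (induction y rule: QB_induct)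
    case (scale d v)
    show ?case
      by (simp add: tens_one_left tens_one_right scale_mult_left scale_mult_right lin_scale pair_mult
          mult.commute)
  next
    case (add x y)
    then show ?case by (simp add: tens_one_left lin_add distrib_left distrib_right)
  qed
next
  case (add x y)
  then show ?case by (simp add: tens_one_right lin_add distrib_left distrib_right)
qed

lemma coproduct_mult: "coproduct (x * y) = coproduct x * coproduct y"
proof (induction x rule: QB_induct)
  case (scale c u)
  show ?case
  proof (induction y rule: QB_induct)
    case (scale d v)
    show ?case
      by (simp add: coproduct_def scale_mult_left scale_mult_right lin_scale mword_mult)
  next
    case (add x y)
    then show ?case by (simp add: coproduct_def lin_add distrib_left)
  qed
next
  case (add x y)
  then show ?case by (simp add: coproduct_def lin_add distrib_right)
qed

lemma primitive_bracket:
  assumes "primitive x" "primitive y"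
  shows "primitive (lie_bracket x y)"
proof -
  have "coproduct (lie_bracket x y) = coproduct x * coproduct y - coproduct y * coproduct x"
    by (simp add: lie_bracket_def coproduct_mult[symmetric]) (simp add: coproduct_def lin_minus)
  also have "\<dots> = (tens x 1 + tens 1 x) * (tens y 1 + tens 1 y)
      - (tens y 1 + tens 1 y) * (tens x 1 + tens 1 x)"
    using assms by (simp add: primitive_def)
  also have "\<dots> = tens x 1 * tens y 1 + tens 1 x * tens 1 y - tens y 1 * tens x 1 - tens 1 y * tens 1 x"
    by (simp add: algebra_simps tens_one_commute)
  also have "\<dots> = tens (lie_bracket x y) 1 + tens 1 (lie_bracket x y)"
    by (simp add: lie_bracket_def tens_one_right_mult[symmetric] tens_one_left_mult[symmetric])
      (simp add: tens_one_left tens_one_right lin_minus)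
  finally show ?thesis by (simp add: primitive_def)
qed

lemma Lie_B_primitive: "x \<in> Lie_B \<Longrightarrow> primitive x"
proof (induction rule: Lie_B.induct)
  case (bracket x y)
  then show ?case by (simp add: primitive_bracket)
qed (simp_all add: primitive_def coproduct_def tens_one_left tens_one_right lin_add lin_scale
    QV.scale_right_distrib)

text \<open>
  \<open>dyn_rev (rev w)\<close> is the left-normed iterated bracket of the letters of \<open>w\<close> (Dynkin operator);
  convolving the identity with it multiplies a word by its length, which gives Friedrichs' theorem.
\<close>

fun dyn_rev :: "nat list \<Rightarrow> QB" where
  "dyn_rev [] = 0"
| "dyn_rev (a # w) = lie_bracket (dyn_rev w) (letter a) + (if w = [] then letter a else 0)"

lemma dyn_rev_Lie: "dyn_rev w \<in> Lie_B"
  by (induction w) (auto intro: Lie_B.intros)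

lemma keys_dyn_rev: "Poly_Mapping.keys (dyn_rev w) \<subseteq> {v. length v = length w}"
proof (induction w)
  case (Cons a w)
  have 1: "Poly_Mapping.keys (dyn_rev w * letter a) \<subseteq> {v. length v = Suc (length w)}"
    using keys_mult[of "dyn_rev w" "letter a"] Cons by (fastforce simp: mword_def plus_list_def)
  have 2: "Poly_Mapping.keys (letter a * dyn_rev w) \<subseteq> {v. length v = Suc (length w)}"
    using keys_mult[of "letter a" "dyn_rev w"] Cons by (fastforce simp: mword_def plus_list_def)
  show ?case
  proof
    fix v assume "v \<in> Poly_Mapping.keys (dyn_rev (a # w))"
    then have "v \<in> Poly_Mapping.keys (dyn_rev w * letter a) \<or> v \<in> Poly_Mapping.keys (letter a * dyn_rev w)
        \<or> (w = [] \<and> v \<in> Poly_Mapping.keys (letter a))"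
      by (auto simp: in_keys_iff lookup_add lookup_minus lie_bracket_def split: if_splits)
    then show "v \<in> {v. length v = length (a # w)}"
      using 1 2 by (auto simp: mword_def)
  qed
qed simp

definition contr :: "((nat list \<times> nat list) \<Rightarrow>\<^sub>0 rat) \<Rightarrow> QB" where
  "contr = lin (\<lambda>(u, v). mword u * dyn_rev (rev v))"

definition counit_right :: "((nat list \<times> nat list) \<Rightarrow>\<^sub>0 rat) \<Rightarrow> QB" where
  "counit_right = lin (\<lambda>(u, v). if v = [] then mword u else 0)"

lemma tens_letter: "tens (letter a) 1 + tens 1 (letter a)
    = Poly_Mapping.single ([a], []) 1 + Poly_Mapping.single ([], [a]) 1"
  by (simp add: tens_one_left tens_one_right)

lemma counit_right_step:
  "counit_right (X * (tens (letter a) 1 + tens 1 (letter a))) = counit_right X * letter a"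
proof (induction X rule: pm_induct)
  case (scale c w)
  obtain u v where [simp]: "w = (u, v)" by (cases w)
  show ?case
    by (simp add: tens_letter counit_right_def scale_mult_left lin_scale distrib_left pair_mult lin_add
        mword_mult)
next
  case (add x y)
  then show ?case by (simp add: counit_right_def lin_add distrib_right)
qed

lemma contr_step:
  "contr (X * (tens (letter a) 1 + tens 1 (letter a)))
    = contr X * letter a + counit_right X * letter a"
proof (induction X rule: pm_induct)
  case (scale c w)
  obtain u v where [simp]: "w = (u, v)" by (cases w)
  have "mword (u @ [a]) = mword u * letter a" by (simp add: mword_mult)
  then show ?case
    by (simp add: tens_letter contr_def counit_right_def scale_mult_left lin_scale distrib_left
        pair_mult lin_add lie_bracket_def QV.scale_right_distrib[symmetric] right_diff_distrib
        mult.assoc)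
next
  case (add x y)
  then show ?case by (simp add: contr_def counit_right_def lin_add distrib_right)
qed

lemma coproduct_snoc:
  "coproduct (mword (w @ [a])) = coproduct (mword w) * (tens (letter a) 1 + tens 1 (letter a))"
  by (simp add: coproduct_def)

lemma counit_right_coproduct_word: "counit_right (coproduct (mword w)) = mword w"
proof (induction w rule: rev_induct)
  case Nil
  show ?case by (simp add: coproduct_def counit_right_def flip: single_pair_one)
next
  case (snoc a w)
  then show ?case by (simp add: coproduct_snoc counit_right_step mword_mult)
qed

lemma contr_coproduct_word: "contr (coproduct (mword w)) = scale (of_nat (length w)) (mword w)"
proof (induction w rule: rev_induct)
  case Nil
  show ?case by (simp add: coproduct_def contr_def flip: single_pair_one)
next
  case (snoc a w)
  then show ?case
    by (simp add: coproduct_snoc contr_step mword_mult counit_right_coproduct_word scale_mult_left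
        QV.scale_left_distrib)
qed

lemma primitive_Lie_B:
  assumes "primitive p"
  shows "p \<in> Lie_B"
proof -
  have gen: "counit_right (coproduct x) = x"
    "contr (coproduct x) = lin (\<lambda>w. scale (of_nat (length w)) (mword w)) x" for x
    by (induction x rule: QB_induct)
      (simp_all add: coproduct_def counit_right_def contr_def lin_add lin_scale
        counit_right_coproduct_word[unfolded coproduct_def counit_right_def, simplified]
        contr_coproduct_word[unfolded coproduct_def contr_def, simplified])
  have t1: "counit_right (tens x 1) = x" for x
    by (induction x rule: QB_induct) (simp_all add: counit_right_def tens_one_right lin_scale lin_add)
  have t2: "counit_right (tens 1 x) = scale (Poly_Mapping.lookup x []) 1" for x
  proof (induction x rule: QB_induct)
    case (scale c w)
    have "counit_right (tens 1 (scale c (mword w))) = scale c (if w = [] then mword [] else 0)"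
      unfolding counit_right_def tens_one_left by (simp only: lin_scale lin_mword lin_single) simp
    then show ?case by (simp add: lookup_mword mword_Nil)
  next
    case (add x y)
    then show ?case
      by (simp add: counit_right_def tens_one_left lin_add lookup_add QV.scale_left_distrib)
  qed
  have t3: "contr (tens x 1) = 0" for x
    by (induction x rule: QB_induct) (simp_all add: contr_def tens_one_right lin_scale lin_add)
  have t4: "contr (tens 1 x) = lin (\<lambda>w. dyn_rev (rev w)) x" for x
  proof (induction x rule: QB_induct)
    case (scale c w)
    have "contr (tens 1 (scale c (mword w))) = scale c (mword [] * dyn_rev (rev w))"
      unfolding contr_def tens_one_left by (simp only: lin_scale lin_mword lin_single) simp
    then show ?case by (simp add: mword_Nil lin_scale)
  next
    case (add x y)
    then show ?case by (simp add: contr_def tens_one_left lin_add)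
  qed
  have pr: "coproduct p = tens p 1 + tens 1 p"
    using assms by (simp add: primitive_def)
  have "p = p + scale (Poly_Mapping.lookup p []) 1"
    using gen(1)[of p] t1[of p] t2[of p] unfolding pr by (simp add: counit_right_def lin_add)
  then have "Poly_Mapping.lookup (scale (Poly_Mapping.lookup p []) (1 :: QB)) [] = 0"
    by simp
  then have p0: "Poly_Mapping.lookup p [] = 0"
    by (simp add: one_eq_single)
  define Y where "Y = lin (\<lambda>w. scale (of_nat (length w)) (mword w))"
  define Z where "Z = lin (\<lambda>w. scale (1 / of_nat (length w)) (mword w))"
  have Yp: "Y p = lin (\<lambda>w. dyn_rev (rev w)) p"
    using gen(2)[of p] t3[of p] t4[of p] unfolding pr Y_def by (simp add: contr_def lin_add)
  have ZY: "Z (Y x) = x - scale (Poly_Mapping.lookup x []) 1" for x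
  proof (induction x rule: QB_induct)
    case (scale c w)
    show ?case
      by (cases "w = []") (simp_all add: Z_def Y_def lin_scale lookup_mword flip: mword_Nil)
  next
    case (add x y)
    have "Z (Y (x + y)) = Z (Y x) + Z (Y y)" by (simp add: Z_def Y_def lin_add)
    with add show ?case by (simp add: lookup_add QV.scale_left_distrib)
  qed
  have Zd: "Z (dyn_rev w) = scale (1 / of_nat (length w)) (dyn_rev w)" for w
  proof -
    have "Z (dyn_rev w) = (\<Sum>v\<in>Poly_Mapping.keys (dyn_rev w).
        scale (Poly_Mapping.lookup (dyn_rev w) v) (scale (1 / of_nat (length w)) (mword v)))"
      unfolding Z_def lin_def using keys_dyn_rev[of w] by (intro sum.cong) auto
    also have "\<dots> = scale (1 / of_nat (length w)) (lin mword (dyn_rev w))"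
      unfolding lin_def by (simp add: QV.scale_sum_right mult.commute)
    finally show ?thesis by simp
  qed
  have "p = Z (Y p)" using ZY[of p] p0 by simp
  also have "\<dots> = (\<Sum>w\<in>Poly_Mapping.keys p. scale (Poly_Mapping.lookup p w) (Z (dyn_rev (rev w))))"
    unfolding Yp lin_def[of _ p] by (simp add: Z_def lin_sum lin_scale)
  finally have "p = (\<Sum>w\<in>Poly_Mapping.keys p. scale (Poly_Mapping.lookup p w) (Z (dyn_rev (rev w))))" .
  moreover have "(\<Sum>w\<in>S. scale (Poly_Mapping.lookup p w) (Z (dyn_rev (rev w)))) \<in> Lie_B" if "finite S" for S
    using that
    by (induction S) (auto simp: Zd intro!: Lie_B.zero Lie_B.add Lie_B.scale dyn_rev_Lie)
  ultimately show ?thesis by (metis finite_keys)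
qed

lemma Lie_B_eq_primitive: "Lie_B = {\<psi>. primitive \<psi>}"
  using Lie_B_primitive primitive_Lie_B by blast

section \<open>Bigrading\<close>

definition weight :: "nat list \<Rightarrow> nat" where
  "weight w = (\<Sum>i\<leftarrow>w. if i = 0 then 1 else i)"

definition depth :: "nat list \<Rightarrow> nat" where
  "depth w = (\<Sum>i\<leftarrow>w. if i = 0 then 0 else 1)"

definition bihomogeneous :: "nat \<Rightarrow> nat \<Rightarrow> QB set" where
  "bihomogeneous n d = {x. \<forall>w\<in>Poly_Mapping.keys x. weight w = n \<and> depth w = d}"

definition bigraded_subspace :: "QB set \<Rightarrow> bool" where
  "bigraded_subspace V \<longleftrightarrow> QV.subspace V \<and> V \<subseteq> Lie_B \<and>
     V = QV.span (\<Union>n. \<Union>d. V \<inter> bihomogeneous n d)"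

section \<open>The derivations \<open>\<partial>\<^sub>\<psi>\<close>\<close>

text \<open>The derivation with prescribed values on the letters.\<close>

fun deriv_word :: "(nat \<Rightarrow> QB) \<Rightarrow> nat list \<Rightarrow> QB" where
  "deriv_word g [] = 0"
| "deriv_word g (i # w) = g i * mword w + letter i * deriv_word g w"

definition derivation_of :: "(nat \<Rightarrow> QB) \<Rightarrow> QB \<Rightarrow> QB" where
  "derivation_of g = lin (deriv_word g)"

text \<open>For a word \<open>w\<close>, \<open>idx w\<close> is the tuple \<open>k\<close> and \<open>subst_idx w l\<close> is \<open>w(l)\<close>.\<close>

definition idx :: "nat list \<Rightarrow> nat list" where
  "idx w = filter (\<lambda>i. 0 < i) w"

fun subst_idx :: "nat list \<Rightarrow> nat list \<Rightarrow> nat list" where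
  "subst_idx [] l = []"
| "subst_idx (i # w) l = (if i = 0 then 0 # subst_idx w l else hd l # subst_idx w (tl l))"

definition below :: "nat list \<Rightarrow> nat list set" where
  "below k = {l. length l = length k \<and> (\<forall>i<length k. 1 \<le> l ! i \<and> l ! i \<le> k ! i)}"

definition binom_tuple :: "nat list \<Rightarrow> nat list \<Rightarrow> nat" where
  "binom_tuple k l = (\<Prod>i<length k. (k ! i - 1) choose (l ! i - 1))"

text \<open>
  For \<open>w = b\<^sub>0\<^sup>m\<close> the tuple \<open>k\<close> is empty and the sum reduces to the single term \<open>[b\<^sub>i, w]\<close>
  (in particular the derivation of the empty word is zero).
\<close>

definition partial_gen :: "nat list \<Rightarrow> nat \<Rightarrow> QB" where
  "partial_gen w i = (if i = 0 then 0 else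
     (\<Sum>l\<in>below (idx w).
        scale ((-1) ^ (sum_list (idx w) + sum_list l) * of_nat (binom_tuple (idx w) l))
          (lie_bracket (letter (i + sum_list (idx w) - sum_list l)) (mword (subst_idx w l)))))"

definition partial :: "QB \<Rightarrow> QB \<Rightarrow> QB" where
  "partial \<psi> x = lin (\<lambda>w. derivation_of (partial_gen w) x) \<psi>"

definition sigma :: "QB \<Rightarrow> QB \<Rightarrow> QB" where
  "sigma \<psi> x = \<psi> * x + partial \<psi> x"

lemma derivation_of_letter: "derivation_of g (letter i) = g i"
  by (simp add: derivation_of_def mword_Nil)

lemma deriv_word_append: "deriv_word g (u @ v) = deriv_word g u * mword v + mword u * deriv_word g v"
proof (induction u)
  case (Cons i u)
  have "letter i * (mword u * z) = mword (i # u) * z" for z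
    by (simp add: mword_mult flip: mult.assoc)
  with Cons show ?case by (simp add: distrib_left distrib_right mult.assoc mword_mult)
qed (simp add: mword_Nil)

lemma derivation_of_mult: "derivation_of g (x * y) = derivation_of g x * y + x * derivation_of g y"
proof (induction x rule: QB_induct)
  case (scale c u)
  show ?case
  proof (induction y rule: QB_induct)
    case (scale d v)
    show ?case
      by (simp add: derivation_of_def scale_mult_left scale_mult_right lin_scale mword_mult
          deriv_word_append QV.scale_right_distrib mult.commute)
  next
    case (add x y)
    then show ?case by (simp add: derivation_of_def lin_add distrib_left)
  qed
next
  case (add x y)
  then show ?case by (simp add: derivation_of_def lin_add distrib_right)
qed

lemma partial_gen_replicate:
  assumes "0 < i"
  shows "partial_gen (replicate m 0) i = lie_bracket (letter i) (mword (replicate m 0))"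
proof -
  have "subst_idx (replicate m 0) [] = replicate m 0" by (induction m) auto
  moreover have "idx (replicate m 0) = []" by (simp add: idx_def)
  moreover have "below [] = {[]}" by (auto simp: below_def)
  ultimately show ?thesis using assms by (simp add: partial_gen_def binom_tuple_def)
qed

section \<open>Words not ending in \<open>b\<^sub>0\<close>\<close>

definition QB0 :: "QB set" where
  "QB0 = QV.span (mword ` {w. w = [] \<or> last w \<noteq> 0})"

definition pi0 :: "QB \<Rightarrow> QB" where
  "pi0 = lin (\<lambda>w. if w = [] \<or> last w \<noteq> 0 then mword w else 0)"

text \<open>
  The linear endomorphism of \<open>QB0\<close> induced by \<open>sigma \<psi>\<close>; functions on \<open>QB0\<close> are taken
  extensional, so that it is unique (see \<open>sigma0_ex1\<close>).
\<close>

definition is_sigma0 :: "QB \<Rightarrow> (QB \<Rightarrow> QB) \<Rightarrow> bool" where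
  "is_sigma0 \<psi> f \<longleftrightarrow> f \<in> QB0 \<rightarrow>\<^sub>E QB0 \<and>
     (\<forall>x\<in>QB0. \<forall>y\<in>QB0. f (x + y) = f x + f y) \<and>
     (\<forall>c. \<forall>x\<in>QB0. f (scale c x) = scale c (f x)) \<and>
     (\<forall>x. pi0 (sigma \<psi> x) = f (pi0 x))"

definition sigma0 :: "QB \<Rightarrow> QB \<Rightarrow> QB" where
  "sigma0 \<psi> = (THE f. is_sigma0 \<psi> f)"

lemma pi0_in: "pi0 x \<in> QB0"
proof (induction x rule: QB_induct)
  case (scale c w)
  then show ?case
    by (auto simp: pi0_def lin_scale QB0_def intro: QV.span_scale QV.span_base QV.span_zero)
next
  case (add x y)
  then show ?case by (auto simp: pi0_def lin_add QB0_def intro: QV.span_add)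
qed

lemma pi0_id: "x \<in> QB0 \<Longrightarrow> pi0 x = x"
  unfolding QB0_def
proof (induction rule: QV.span_induct_alt)
  case base
  show ?case by (simp add: pi0_def)
next
  case (step c x y)
  then show ?case by (auto simp: pi0_def lin_add lin_scale)
qed

lemma pi0_add: "pi0 (x + y) = pi0 x + pi0 y"
  by (simp add: pi0_def lin_add)

lemma pi0_scale: "pi0 (scale c x) = scale c (pi0 x)"
  by (simp add: pi0_def lin_scale)

lemma pi0_mult_b0: "pi0 (x * letter 0) = 0"
  by (induction x rule: QB_induct)
    (simp_all add: pi0_def scale_mult_left lin_scale lin_add distrib_right mword_mult)

lemma partial_mult: "partial \<psi> (x * y) = partial \<psi> x * y + x * partial \<psi> y"
  unfolding partial_def lin_def
  by (simp add: derivation_of_mult QV.scale_right_distrib sum.distrib sum_distrib_left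
      sum_distrib_right scale_mult_left scale_mult_right)

lemma partial_add: "partial \<psi> (x + y) = partial \<psi> x + partial \<psi> y"
  unfolding partial_def derivation_of_def lin_def[of _ \<psi>]
  by (simp add: lin_add QV.scale_right_distrib sum.distrib)

lemma partial_scale: "partial \<psi> (scale c x) = scale c (partial \<psi> x)"
  unfolding partial_def derivation_of_def lin_def[of _ \<psi>]
  by (simp add: lin_scale QV.scale_sum_right mult.commute)

lemma partial_b0: "partial \<psi> (letter 0) = 0"
  unfolding partial_def lin_def by (simp add: derivation_of_letter partial_gen_def)

lemma sigma_add: "sigma \<psi> (x + y) = sigma \<psi> x + sigma \<psi> y"
  by (simp add: sigma_def partial_add distrib_left)

lemma sigma_scale: "sigma \<psi> (scale c x) = scale c (sigma \<psi> x)"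
  by (simp add: sigma_def partial_scale scale_mult_right QV.scale_right_distrib)

lemma sigma_mult_b0: "sigma \<psi> (x * letter 0) = sigma \<psi> x * letter 0"
  by (simp add: sigma_def partial_mult partial_b0 distrib_right mult.assoc)

lemma pi0_sigma: "pi0 (sigma \<psi> x) = pi0 (sigma \<psi> (pi0 x))"
proof (induction x rule: QB_induct)
  case (scale c w)
  have "sigma \<psi> 0 = 0" using sigma_scale[of \<psi> 0 0] by simp
  moreover have "pi0 (sigma \<psi> (mword w)) = 0" if "w \<noteq> []" "last w = 0"
  proof -
    have "mword w = mword (butlast w) * letter 0"
      using that by (metis append_butlast_last_id mword_mult)
    then show ?thesis by (simp add: sigma_mult_b0 pi0_mult_b0)
  qed
  ultimately show ?case by (auto simp: pi0_def lin_scale sigma_scale)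
next
  case (add x y)
  then show ?case by (simp add: pi0_def lin_add sigma_add)
qed

lemma sigma0_ex1: "\<exists>!f. is_sigma0 \<psi> f"
proof
  have cl: "x + y \<in> QB0" if "x \<in> QB0" "y \<in> QB0" for x y
    using that by (simp add: QB0_def QV.span_add)
  have cl': "scale c x \<in> QB0" if "x \<in> QB0" for x c
    using that by (simp add: QB0_def QV.span_scale)
  show "is_sigma0 \<psi> (\<lambda>x\<in>QB0. pi0 (sigma \<psi> x))"
    unfolding is_sigma0_def
  proof (intro conjI ballI allI)
    show "pi0 (sigma \<psi> x) = (\<lambda>x\<in>QB0. pi0 (sigma \<psi> x)) (pi0 x)" for x
      using pi0_sigma pi0_in by simp
  qed (auto simp: pi0_in cl cl' sigma_add sigma_scale pi0_add pi0_scale)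
next
  fix f assume f: "is_sigma0 \<psi> f"
  show "f = (\<lambda>x\<in>QB0. pi0 (sigma \<psi> x))"
  proof
    fix x
    show "f x = (\<lambda>x\<in>QB0. pi0 (sigma \<psi> x)) x"
    proof (cases "x \<in> QB0")
      case True
      then show ?thesis using f by (simp add: is_sigma0_def pi0_id)
    next
      case False
      have "f \<in> QB0 \<rightarrow>\<^sub>E QB0" using f unfolding is_sigma0_def by blast
      then have "f x = undefined" using False by (rule PiE_arb)
      with False show ?thesis by simp
    qed
  qed
qed

lemma sigma0_eq:
  assumes "x \<in> QB0"
  shows "sigma0 \<psi> x = pi0 (sigma \<psi> x)"
proof -
  have "is_sigma0 \<psi> (sigma0 \<psi>)"
    unfolding sigma0_def by (rule theI'[OF sigma0_ex1])
  then have "pi0 (sigma \<psi> x) = sigma0 \<psi> (pi0 x)"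
    unfolding is_sigma0_def by blast
  with assms show ?thesis by (simp add: pi0_id)
qed

text \<open>
  \<open>tau_word m w\<close> is the image under \<open>\<tau>\<close> of \<open>b\<^sub>0\<^sup>m w\<close>: reading a word from the left, \<open>m\<close> counts the
  letters \<open>b\<^sub>0\<close> since the last completed block \<open>b\<^sub>0\<^sup>m b\<^sub>k\<close>. The value on words ending in \<open>b\<^sub>0\<close> is
  irrelevant: \<open>tau\<close> is only used on \<open>QB0\<close>.
\<close>

fun tau_word :: "nat \<Rightarrow> nat list \<Rightarrow> nat list" where
  "tau_word m [] = []"
| "tau_word m (k # w) =
     (if k = 0 then tau_word (Suc m) w
      else tau_word 0 w @ replicate (k - 1) 0 @ [m + 1])"

definition tau :: "QB \<Rightarrow> QB" where
  "tau = lin (\<lambda>w. mword (tau_word 0 w))"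

lemma tau_word_block:
  "0 < k \<Longrightarrow> tau_word n (replicate m 0 @ k # w) = tau_word 0 w @ replicate (k - 1) 0 @ [n + m + 1]"
  by (induction m arbitrary: n) auto

lemma tau_generator:
  "0 < k \<Longrightarrow> tau (mword (replicate m 0 @ [k])) = mword (replicate (k - 1) 0 @ [m + 1])"
  by (simp add: tau_def tau_word_block)

lemma tau_word_append:
  "u \<noteq> [] \<Longrightarrow> last u \<noteq> 0 \<Longrightarrow> tau_word m (u @ v) = tau_word 0 v @ tau_word m u"
  by (induction m u rule: tau_word.induct) (auto split: if_splits)

lemma tau_mult:
  assumes "x \<in> QB0" "y \<in> QB0"
  shows "tau (x * y) = tau y * tau x"
  using assms(1) unfolding QB0_def
proof (induction rule: QV.span_induct_alt)
  case base
  show ?case by (simp add: tau_def)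
next
  case (step c x x')
  then obtain u where u: "x = mword u" "u = [] \<or> last u \<noteq> 0" by auto
  have "tau (mword u * y) = tau y * tau (mword u)"
  proof (induction y rule: QB_induct)
    case (scale d v)
    have "tau_word 0 (u @ v) = tau_word 0 v @ tau_word 0 u"
      using u tau_word_append by (cases "u = []") auto
    then show ?case
      by (simp add: tau_def scale_mult_left scale_mult_right lin_scale mword_mult)
  next
    case (add x y)
    then show ?case by (simp add: tau_def lin_add distrib_left distrib_right)
  qed
  with step u show ?case
    by (simp add: tau_def lin_add lin_scale scale_mult_left scale_mult_right distrib_left
        distrib_right)
qed

section \<open>The stabilizer of \<open>\<tau>\<close> and \<open>lq\<close>\<close>

definition stab_tau :: "QB set" where
  "stab_tau = {\<psi>\<in>Lie_B. \<forall>x\<in>QB0. sigma0 \<psi> (tau x) = tau (sigma0 \<psi> x)}"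

definition lq :: "QB set" where
  "lq = {\<psi>. Poly_Mapping.lookup \<psi> [0] = 0 \<and>
     coproduct \<psi> = tens \<psi> 1 + tens 1 \<psi> \<and>
     tau (pi0 \<psi>) = pi0 \<psi> \<and>
     (\<forall>m k. 1 \<le> k \<and> even (k + m) \<longrightarrow> Poly_Mapping.lookup \<psi> (replicate m 0 @ [k]) = 0)}"

end

theory Submission
  imports Defs "HOL-Computational_Algebra.Polynomial"
begin

text \<open>
  Reading words of depth \<open>d\<close> as monomials in \<open>(x\<^sub>1, y\<^sub>1), \<dots>, (x\<^sub>d, y\<^sub>d), x\<^sub>d\<^sub>+\<^sub>1\<close>, an element of \<open>QB0\<close> becomes
  a family of polynomials (\<open>x\<^sub>d\<^sub>+\<^sub>1 = 0\<close>), \<open>\<tau>\<close> becomes the reversal of the points combined with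
  \<open>x \<leftrightarrow> y\<close>, and the binomial sum in \<open>\<partial>\<^sub>w b\<^sub>i\<close> becomes the substitution \<open>y\<^sub>j \<mapsto> y\<^sub>j - y\<close>. A Lie element is
  invariant under translation of all \<open>x\<^sub>i\<close>, so \<open>\<sigma>\<^sub>\<psi> g\<close> is an explicit sum of products of \<open>g\<close> with the
  polynomials \<open>f\<close> of \<open>\<pi>\<^sub>0 \<psi>\<close> at differences of points. If \<open>f\<close> is \<open>\<tau>\<close>-invariant, one half of this sum
  commutes with \<open>\<tau>\<close>, and the other half does so if \<open>f\<close> is push invariant:
  \<open>f(w\<^sub>1 - w\<^sub>0, \<dots>, w\<^sub>d - w\<^sub>0) = f(w\<^sub>0 - w\<^sub>d, \<dots>, w\<^sub>d\<^sub>-\<^sub>1 - w\<^sub>d)\<close>. The antipode relation and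
  \<open>\<tau>\<close>-invariance give this identity up to the sign of all variables. The odd part of \<open>f\<close> then changes
  sign under cyclic rotation, and the shuffle relations with one letter force it to vanish for \<open>d \<ge> 2\<close>.
  In depth one, push invariance is the parity condition of \<open>lq\<close>; conversely, commutation of \<open>\<sigma>\<^sub>\<psi>\<close> with
  \<open>\<tau>\<close> on \<open>1\<close> and on \<open>b\<^sub>1\<close> yields \<open>\<tau>\<close>-invariance and parity. Finally \<open>\<sigma>\<close> of \<open>b\<^sub>0\<close> is right
  multiplication by \<open>b\<^sub>0\<close>, which \<open>\<pi>\<^sub>0\<close> kills.
\<close>

section \<open>Sums over the splittings of a list\<close>

text \<open>Recursion replaces a sum over a set of cuts; \<open>f\<close> absorbs the prefix already
  read, so the rules below are inductions with \<open>f\<close> arbitrary.\<close>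

fun split_sum :: "('a list \<Rightarrow> 'a list \<Rightarrow> rat) \<Rightarrow> 'a list \<Rightarrow> rat" where
  "split_sum f [] = f [] []"
| "split_sum f (a # ws) = f [] (a # ws) + split_sum (\<lambda>p. f (a # p)) ws"

definition split3_sum :: "('a list \<Rightarrow> 'a list \<Rightarrow> 'a list \<Rightarrow> rat) \<Rightarrow> 'a list \<Rightarrow> rat" where
  "split3_sum f ws = split_sum (\<lambda>p r. split_sum (f p) r) ws"

lemma split_sum_cong:
  "(\<And>p q. p @ q = ws \<Longrightarrow> f p q = g p q) \<Longrightarrow> split_sum f ws = split_sum g ws"
proof (induction ws arbitrary: f g)
  case (Cons a ws)
  have "split_sum (\<lambda>p. f (a # p)) ws = split_sum (\<lambda>p. g (a # p)) ws"
    by (rule Cons.IH) (simp add: Cons.prems)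
  then show ?case using Cons.prems[of "[]"] by simp
qed simp

lemma split_sum_add: "split_sum (\<lambda>p q. f p q + g p q) ws = split_sum f ws + split_sum g ws"
  by (induction ws arbitrary: f g) simp_all

lemma split_sum_diff: "split_sum (\<lambda>p q. f p q - g p q) ws = split_sum f ws - split_sum g ws"
  by (induction ws arbitrary: f g) simp_all

lemma split_sum_uminus: "split_sum (\<lambda>p q. - f p q) ws = - split_sum f ws"
  by (induction ws arbitrary: f) simp_all

lemma split_sum_zero [simp]: "split_sum (\<lambda>p q. 0) ws = 0"
  by (induction ws) simp_all

lemma split_sum_mult_left: "split_sum (\<lambda>p q. c * f p q) ws = c * split_sum f ws"
  by (induction ws arbitrary: f) (simp_all add: distrib_left)

lemma split_sum_mult_right: "split_sum (\<lambda>p q. f p q * c) ws = split_sum f ws * c"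
  by (induction ws arbitrary: f) (simp_all add: distrib_right)

lemma split_sum_snoc: "split_sum f (ws @ [a]) = split_sum (\<lambda>p q. f p (q @ [a])) ws + f (ws @ [a]) []"
  by (induction ws arbitrary: f) simp_all

text \<open>The cut falls either left or right of the marked entry \<open>a\<close>, which will be
  the inserted point.\<close>

lemma split_sum_append_Cons:
  "split_sum F (p @ a # q)
    = split_sum (\<lambda>p1 p2. F p1 (p2 @ a # q)) p + split_sum (\<lambda>q1. F (p @ a # q1)) q"
  by (induction p arbitrary: F) (simp_all add: add.assoc)

lemma split_sum_Nil_left: "split_sum (\<lambda>p q. if p = [] then f p q else 0) ws = f [] ws"
  by (cases ws) simp_all

lemma split_sum_Nil_right: "split_sum (\<lambda>p q. if q = [] then f p q else 0) ws = f ws []"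
  by (induction ws arbitrary: f) simp_all

lemma split_sum_map: "split_sum f (map h ws) = split_sum (\<lambda>p q. f (map h p) (map h q)) ws"
  by (induction ws arbitrary: f) simp_all

lemma split_sum_rev: "split_sum f (rev ws) = split_sum (\<lambda>p q. f (rev q) (rev p)) ws"
  by (induction ws arbitrary: f) (simp_all add: split_sum_snoc add.commute)

lemma split_sum_assoc: "split_sum (\<lambda>r q. split_sum (\<lambda>p u. f p u q) r) ws = split3_sum f ws"
  by (induction ws arbitrary: f) (simp_all add: split3_sum_def split_sum_add)

lemma split3_sum_cong:
  "(\<And>p u q. p @ u @ q = ws \<Longrightarrow> f p u q = g p u q) \<Longrightarrow> split3_sum f ws = split3_sum g ws"
  unfolding split3_sum_def by (blast intro: split_sum_cong)

lemma split3_sum_Cons: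
  "split3_sum f (a # ws) = split_sum (f []) (a # ws) + split3_sum (\<lambda>p. f (a # p)) ws"
  by (simp add: split3_sum_def)

lemma split3_sum_add:
  "split3_sum (\<lambda>p u q. f p u q + g p u q) ws = split3_sum f ws + split3_sum g ws"
  by (simp add: split3_sum_def split_sum_add)

lemma split3_sum_minus:
  "split3_sum (\<lambda>p u q. f p u q - g p u q) ws = split3_sum f ws - split3_sum g ws"
  by (simp add: split3_sum_def split_sum_diff)

lemma split3_sum_mult_left: "split3_sum (\<lambda>p u q. c * f p u q) ws = c * split3_sum f ws"
  by (simp add: split3_sum_def split_sum_mult_left)

lemma split3_sum_map:
  "split3_sum f (map h ws) = split3_sum (\<lambda>p u q. f (map h p) (map h u) (map h q)) ws"
  by (simp add: split3_sum_def split_sum_map)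

lemma split3_sum_rev:
  "split3_sum f (rev ws) = split3_sum (\<lambda>p u q. f (rev q) (rev u) (rev p)) ws"
  by (subst split_sum_assoc[symmetric]) (simp add: split3_sum_def split_sum_rev)

section \<open>Words as monomials\<close>

fun head_x :: "(rat \<times> rat) list \<Rightarrow> rat \<Rightarrow> rat" where
  "head_x [] z = z"
| "head_x (a # ws) z = fst a"

text \<open>The default 0 lets left multiplication by \<open>\<psi>\<close> count as an insertion
  behind an empty prefix.\<close>

fun last_y :: "(rat \<times> rat) list \<Rightarrow> rat" where
  "last_y [] = 0"
| "last_y (a # ws) = (if ws = [] then snd a else last_y ws)"

lemma head_x_append [simp]: "head_x (p @ q) z = head_x p (head_x q z)"
  by (cases p) auto

text \<open>
  The word \<open>b\<^sub>0\<^sup>m\<^sup>1 b\<^sub>k\<^sub>1 \<dots> b\<^sub>0\<^sup>m\<^sup>d b\<^sub>k\<^sub>d b\<^sub>0\<^sup>m\<close> is read as the monomial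
  \<open>\<Prod>\<^sub>i x\<^sub>i\<^sup>m\<^sup>i y\<^sub>i\<^bsup>k\<^sub>i - 1\<^esup> \<cdot> z\<^sup>m\<close> at the point \<open>[(x\<^sub>1, y\<^sub>1), \<dots>, (x\<^sub>d, y\<^sub>d)]\<close>, \<open>z\<close>. The value is zero
  when the number of points differs from the depth, so that evaluation at \<open>d\<close> points extracts the
  depth \<open>d\<close> part.
\<close>

fun eval_word :: "nat list \<Rightarrow> (rat \<times> rat) list \<Rightarrow> rat \<Rightarrow> rat" where
  "eval_word [] ws z = (if ws = [] then 1 else 0)"
| "eval_word (i # w) ws z = (if i = 0 then head_x ws z * eval_word w ws z
     else case ws of [] \<Rightarrow> 0 | a # ws' \<Rightarrow> snd a ^ (i - 1) * eval_word w ws' z)"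

definition ev :: "QB \<Rightarrow> (rat \<times> rat) list \<Rightarrow> rat \<Rightarrow> rat" where
  "ev x ws z = (\<Sum>w\<in>Poly_Mapping.keys x. Poly_Mapping.lookup x w * eval_word w ws z)"

lemma ev_superset:
  assumes "finite S" "Poly_Mapping.keys x \<subseteq> S"
  shows "ev x ws z = (\<Sum>w\<in>S. Poly_Mapping.lookup x w * eval_word w ws z)"
  unfolding ev_def
  by (rule sum.mono_neutral_left) (use assms in \<open>auto simp: in_keys_iff\<close>)

lemma ev_add: "ev (x + y) ws z = ev x ws z + ev y ws z"
proof -
  let ?S = "Poly_Mapping.keys x \<union> Poly_Mapping.keys y"
  have "ev (x + y) ws z = (\<Sum>w\<in>?S. Poly_Mapping.lookup (x + y) w * eval_word w ws z)"
    by (rule ev_superset) (simp_all add: Poly_Mapping.keys_add)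
  then show ?thesis
    by (simp add: lookup_add distrib_right sum.distrib ev_superset[of ?S])
qed

lemma ev_scale: "ev (scale c x) ws z = c * ev x ws z"
proof -
  have "ev (scale c x) ws z = (\<Sum>w\<in>Poly_Mapping.keys x. Poly_Mapping.lookup (scale c x) w * eval_word w ws z)"
    by (rule ev_superset) (auto simp: in_keys_iff)
  then show ?thesis by (simp add: ev_def sum_distrib_left mult.assoc)
qed

lemma ev_mword [simp]: "ev (mword w) ws z = eval_word w ws z"
  by (simp add: ev_def mword_def)

lemma ev_zero [simp]: "ev 0 ws z = 0"
  by (simp add: ev_def)

lemma ev_minus: "ev (x - y) ws z = ev x ws z - ev y ws z"
  using ev_add[of "x - y" y] by simp

lemma ev_sum: "ev (sum g A) ws z = (\<Sum>a\<in>A. ev (g a) ws z)"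
  by (induction A rule: infinite_finite_induct) (auto simp: ev_add)

text \<open>Only the cut matching the depth of \<open>u\<close> contributes. Trailing letters
  \<open>b_0\<close> of \<open>u\<close> run into the first block of \<open>v\<close>, hence
  \<open>head_x q z\<close>.\<close>

lemma eval_word_append:
  "eval_word (u @ v) ws z = split_sum (\<lambda>p q. eval_word u p (head_x q z) * eval_word v q z) ws"
proof (induction u arbitrary: ws)
  case Nil
  have "split_sum (\<lambda>p q. eval_word [] p (head_x q z) * eval_word v q z) ws
      = split_sum (\<lambda>p q. if p = [] then eval_word v q z else 0) ws"
    by (rule split_sum_cong) simp
  then show ?case by (simp add: split_sum_Nil_left)
next
  case (Cons i u)
  show ?case
  proof (cases "i = 0")
    case True
    have "split_sum (\<lambda>p q. eval_word (i # u) p (head_x q z) * eval_word v q z) ws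
        = split_sum (\<lambda>p q. head_x ws z * (eval_word u p (head_x q z) * eval_word v q z)) ws"
      using True by (intro split_sum_cong) auto
    with True Cons show ?thesis by (simp add: split_sum_mult_left)
  next
    case False
    with Cons show ?thesis
      by (cases ws) (simp_all add: split_sum_mult_left mult.assoc)
  qed
qed

lemma ev_mult: "ev (x * y) ws z = split_sum (\<lambda>p q. ev x p (head_x q z) * ev y q z) ws"
proof (induction x rule: QB_induct)
  case (scale c u)
  show ?case
  proof (induction y rule: QB_induct)
    case (scale d v)
    have "split_sum (\<lambda>p q. ev (Defs.scale c (mword u)) p (head_x q z) * ev (Defs.scale d (mword v)) q z) ws
        = split_sum (\<lambda>p q. (d * c) * (eval_word u p (head_x q z) * eval_word v q z)) ws"
      by (rule split_sum_cong) (simp add: ev_scale)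
    then show ?case
      by (simp add: ev_scale scale_mult_left scale_mult_right mword_mult eval_word_append split_sum_mult_left)
  next
    case (add x y)
    then show ?case by (simp add: ev_add distrib_left split_sum_add)
  qed
next
  case (add x y)
  then show ?case by (simp add: ev_add distrib_right split_sum_add)
qed

lemma eval_word_last_zero: "w \<noteq> [] \<Longrightarrow> last w = 0 \<Longrightarrow> eval_word w ws 0 = 0"
proof (induction w arbitrary: ws)
  case (Cons i w)
  then show ?case by (cases "w = []"; cases ws) auto
qed simp

lemma ev_pi0: "ev (pi0 x) ws 0 = ev x ws 0"
proof (induction x rule: QB_induct)
  case (scale c w)
  then show ?case by (auto simp: pi0_def lin_scale ev_scale eval_word_last_zero)
next
  case (add x y)
  then show ?case by (simp add: pi0_add ev_add)
qed

subsection \<open>Elements are determined by their evaluations\<close>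

fun block_word :: "(nat \<times> nat) list \<Rightarrow> nat list" where
  "block_word [] = []"
| "block_word ((m, n) # bs) = replicate m 0 @ Suc n # block_word bs"

fun block_mon :: "(nat \<times> nat) list \<Rightarrow> (rat \<times> rat) list \<Rightarrow> rat" where
  "block_mon ((m, n) # bs) (a # ws) = fst a ^ m * snd a ^ n * block_mon bs ws"
| "block_mon [] [] = 1"
| "block_mon _ _ = 0"

lemma eval_word_replicate_zero:
  "eval_word (replicate m 0 @ w) ws z = head_x ws z ^ m * eval_word w ws z"
  by (induction m) auto

lemma eval_block_word: "eval_word (block_word bs) ws z = block_mon bs ws"
  by (induction bs ws rule: block_mon.induct) (auto simp: eval_word_replicate_zero)

lemma depth_Cons [simp]: "depth (i # w) = (if i = 0 then 0 else 1) + depth w"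
  and depth_Nil [simp]: "depth [] = 0"
  by (simp_all add: depth_def)

lemma depth_append [simp]: "depth (u @ v) = depth u + depth v"
  by (induction u) auto

lemma depth_replicate_zero [simp]: "depth (replicate m 0) = 0"
  by (induction m) auto

lemma depth_block_word: "depth (block_word bs) = length bs"
  by (induction bs rule: block_word.induct) auto

lemma inj_block_word: "inj block_word"
proof (rule injI)
  show "block_word bs = block_word cs \<Longrightarrow> bs = cs" for bs cs
  proof (induction bs arbitrary: cs rule: block_word.induct)
    case 1
    then show ?case by (cases cs rule: block_word.cases) auto
  next
    case (2 m n bs)
    from "2.prems" obtain m' n' cs' where cs: "cs = (m', n') # cs'"
      by (cases cs rule: block_word.cases) auto
    have *: "replicate m 0 @ Suc n # u = replicate m' 0 @ Suc n' # v \<Longrightarrow> m = m' \<and> n = n' \<and> u = v" for u v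
    proof (induction m arbitrary: m')
      case 0
      then show ?case by (cases m') auto
    next
      case (Suc m)
      then show ?case by (cases m') auto
    qed
    from *[of "block_word bs" "block_word cs'"] "2.prems" have "m = m'" "n = n'" "block_word bs = block_word cs'"
      unfolding cs by simp_all
    with "2.IH" cs show ?case by simp
  qed
qed

lemma ex_block_word: "w = [] \<or> last w \<noteq> 0 \<Longrightarrow> \<exists>bs. w = block_word bs"
proof (induction w)
  case Nil
  have "[] = block_word []" by simp
  then show ?case by blast
next
  case (Cons i w)
  have "w = [] \<or> last w \<noteq> 0" using Cons.prems by (auto split: if_splits)
  with Cons.IH obtain bs where bs: "w = block_word bs" by blast
  show ?case
  proof (cases i)
    case 0
    with Cons.prems bs have "bs \<noteq> []" by auto
    then obtain m n cs where "bs = (m, n) # cs" by (cases bs) auto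
    with bs 0 have "i # w = block_word ((Suc m, n) # cs)" by simp
    then show ?thesis by blast
  next
    case (Suc n)
    with bs have "i # w = block_word ((0, n) # bs)" by simp
    then show ?thesis by blast
  qed
qed

definition blocks :: "nat \<Rightarrow> nat \<Rightarrow> (nat \<times> nat) list set" where
  "blocks N d = {bs. set bs \<subseteq> {..N} \<times> {..N} \<and> length bs = d}"

lemma finite_blocks: "finite (blocks N d)"
  unfolding blocks_def by (rule finite_lists_length_eq) simp

lemma sum_blocks_Suc:
  "(\<Sum>bs\<in>blocks N (Suc d). g bs) = (\<Sum>m\<le>N. \<Sum>n\<le>N. \<Sum>bs\<in>blocks N d. g ((m, n) # bs) :: rat)"
proof -
  have "bij_betw (\<lambda>((m, n), bs). (m, n) # bs) (({..N} \<times> {..N}) \<times> blocks N d) (blocks N (Suc d))"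
    by (rule bij_betw_byWitness[where f' = "\<lambda>bs. (hd bs, tl bs)"])
      (auto simp: blocks_def length_Suc_conv)
  from sum.reindex_bij_betw[OF this, of g]
  have "sum g (blocks N (Suc d)) = (\<Sum>mn\<in>{..N} \<times> {..N}. \<Sum>bs\<in>blocks N d. g (mn # bs))"
    by (simp add: sum.cartesian_product case_prod_unfold)
  also have "\<dots> = (\<Sum>m\<le>N. \<Sum>n\<le>N. \<Sum>bs\<in>blocks N d. g ((m, n) # bs))"
    by (subst sum.cartesian_product) (simp add: case_prod_unfold)
  finally show ?thesis .
qed

lemma rat_polyfun_eq_0:
  fixes c :: "nat \<Rightarrow> rat"
  assumes "\<And>x. (\<Sum>i\<le>n. c i * x ^ i) = 0" "i \<le> n"
  shows "c i = 0"
proof -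
  let ?p = "\<Sum>i\<le>n. monom (c i) i"
  have "poly ?p x = 0" for x
    using assms(1) by (simp add: poly_sum poly_monom)
  then have "?p = 0" using poly_all_0_iff_0 by blast
  then have "coeff ?p i = 0" by simp
  then show ?thesis using assms(2) by (simp add: coeff_sum)
qed

text \<open>Distinct monomials are independent: the two coordinates of the first point are removed
  one at a time as variables of one-variable polynomials.\<close>

lemma block_mon_independent:
  assumes "\<And>ws. length ws = d \<Longrightarrow> (\<Sum>bs\<in>blocks N d. c bs * block_mon bs ws) = 0"
    and "bs \<in> blocks N d"
  shows "c bs = 0"
  using assms
proof (induction d arbitrary: c bs)
  case 0
  have "blocks N 0 = {[]}" by (auto simp: blocks_def)
  with 0(1)[of "[]"] 0(2) show ?case by simp
next
  case (Suc d)
  obtain m n cs where bs: "bs = (m, n) # cs" "m \<le> N" "n \<le> N" "cs \<in> blocks N d"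
    using Suc.prems(2) by (auto simp: blocks_def length_Suc_conv)
  have "(\<Sum>cs\<in>blocks N d. c ((m, n) # cs) * block_mon cs ws) = 0" if ws: "length ws = d" for ws
  proof -
    let ?S = "\<lambda>m n. \<Sum>cs\<in>blocks N d. c ((m, n) # cs) * block_mon cs ws"
    have eq: "(\<Sum>m\<le>N. (\<Sum>n\<le>N. ?S m n * y ^ n) * x ^ m) = 0" for x y
      using Suc.prems(1)[of "(x, y) # ws"] ws
      by (simp add: sum_blocks_Suc sum_distrib_left sum_distrib_right mult.assoc mult.commute mult.left_commute)
    have "(\<Sum>n\<le>N. ?S m n * y ^ n) = 0" for y
      by (rule rat_polyfun_eq_0[OF eq bs(2)])
    then show ?thesis by (rule rat_polyfun_eq_0[OF _ bs(3)])
  qed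
  from Suc.IH[of "\<lambda>cs. c ((m, n) # cs)", OF this bs(4)] bs(1) show ?case by simp
qed

lemma eval_word_eq_0: "depth w \<noteq> length ws \<Longrightarrow> eval_word w ws z = 0"
proof (induction w arbitrary: ws)
  case (Cons i w)
  then show ?case by (cases ws) auto
qed auto

text \<open>At \<open>d\<close> points with \<open>z = 0\<close>, words of another depth and words
  ending in \<open>b_0\<close> vanish. What remains is a finite combination of distinct
  monomials.\<close>

lemma lookup_eq_0_if_ev_eq_0:
  assumes ev: "\<And>ws. length ws = d \<Longrightarrow> ev x ws 0 = 0"
    and w: "w = [] \<or> last w \<noteq> 0" "depth w = d"
  shows "Poly_Mapping.lookup x w = 0"
proof -
  obtain bs where bs: "w = block_word bs" using ex_block_word w by blast
  \<comment> \<open>\<open>bs\<close> is added so that the exponent bound \<open>N\<close> covers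
    \<open>w\<close> even if \<open>w\<close> lies outside the support of \<open>x\<close>.\<close>
  define A where "A = insert bs (block_word -` Poly_Mapping.keys x)"
  have "finite A"
    unfolding A_def by (simp add: finite_vimageI inj_block_word)
  then have "finite (\<Union>bs\<in>A. fst ` set bs \<union> snd ` set bs)" by simp
  then obtain N where N': "\<forall>i\<in>(\<Union>bs\<in>A. fst ` set bs \<union> snd ` set bs). i \<le> N"
    unfolding finite_nat_set_iff_bounded_le by blast
  have N: "set cs \<subseteq> {..N} \<times> {..N}" if "cs \<in> A" for cs
  proof
    fix b assume "b \<in> set cs"
    with that N' have "fst b \<le> N" "snd b \<le> N" by blast+
    then show "b \<in> {..N} \<times> {..N}" by (simp add: mem_Times_iff)
  qed
  have "(\<Sum>cs\<in>blocks N d. Poly_Mapping.lookup x (block_word cs) * block_mon cs ws) = 0"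
    if ws: "length ws = d" for ws
  proof -
    have "ev x ws 0 = (\<Sum>u\<in>Poly_Mapping.keys x \<union> block_word ` blocks N d. Poly_Mapping.lookup x u * eval_word u ws 0)"
      by (rule ev_superset) (auto simp: finite_blocks)
    also have "\<dots> = (\<Sum>u\<in>block_word ` blocks N d. Poly_Mapping.lookup x u * eval_word u ws 0)"
    proof (rule sum.mono_neutral_right)
      show "\<forall>u\<in>Poly_Mapping.keys x \<union> block_word ` blocks N d - block_word ` blocks N d.
          Poly_Mapping.lookup x u * eval_word u ws 0 = 0"
      proof
        fix u assume u: "u \<in> Poly_Mapping.keys x \<union> block_word ` blocks N d - block_word ` blocks N d"
        have "eval_word u ws 0 = 0"
        proof (cases "u = [] \<or> last u \<noteq> 0")
          case True
          then obtain cs where cs: "u = block_word cs" using ex_block_word by blast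
          with u have "cs \<in> A" "cs \<notin> blocks N d" by (auto simp: A_def)
          with N have "length cs \<noteq> d" by (auto simp: blocks_def)
          with cs ws show ?thesis by (simp add: eval_word_eq_0 depth_block_word)
        next
          case False
          then show ?thesis by (simp add: eval_word_last_zero)
        qed
        then show "Poly_Mapping.lookup x u * eval_word u ws 0 = 0" by simp
      qed
    qed (auto simp: finite_blocks)
    also have "\<dots> = (\<Sum>cs\<in>blocks N d. Poly_Mapping.lookup x (block_word cs) * block_mon cs ws)"
      by (subst sum.reindex[OF inj_on_subset[OF inj_block_word]]) (simp_all add: eval_block_word)
    finally show ?thesis using ev[OF ws] by simp
  qed
  moreover have "bs \<in> blocks N d"
    using N[of bs] w(2) bs by (simp add: A_def blocks_def depth_block_word)
  ultimately show ?thesis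
    unfolding bs by (rule block_mon_independent)
qed

lemma QB0_lookup: "x \<in> QB0 \<Longrightarrow> w \<noteq> [] \<Longrightarrow> last w = 0 \<Longrightarrow> Poly_Mapping.lookup x w = 0"
  unfolding QB0_def
proof (induction rule: QV.span_induct_alt)
  case (step c x y)
  then obtain u where "x = mword u" "u = [] \<or> last u \<noteq> 0" by auto
  with step show ?case by (auto simp: lookup_add lookup_mword)
qed simp

text \<open>Reduces identities in \<open>QB0\<close>, in particular commutation with
  \<open>tau\<close>, to identities between polynomial functions.\<close>

lemma QB0_eqI:
  assumes "x \<in> QB0" "y \<in> QB0" "\<And>ws. ev x ws 0 = ev y ws 0"
  shows "x = y"
proof (rule poly_mapping_eqI)
  fix w
  show "Poly_Mapping.lookup x w = Poly_Mapping.lookup y w"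
  proof (cases "w = [] \<or> last w \<noteq> 0")
    case True
    then have "Poly_Mapping.lookup (x - y) w = 0"
      by (intro lookup_eq_0_if_ev_eq_0[of "depth w"]) (simp_all add: ev_minus assms(3))
    then show ?thesis by (simp add: lookup_minus)
  next
    case False
    then show ?thesis using assms QB0_lookup by simp
  qed
qed

subsection \<open>The antiautomorphism \<open>\<tau>\<close>\<close>

abbreviation swap_rev :: "(rat \<times> rat) list \<Rightarrow> (rat \<times> rat) list" where
  "swap_rev ws \<equiv> rev (map prod.swap ws)"

lemma tau_word_last: "tau_word m w = [] \<or> last (tau_word m w) \<noteq> 0"
  by (induction m w rule: tau_word.induct) auto

lemma tau_in_QB0: "tau x \<in> QB0"
proof (induction x rule: QB_induct)
  case (scale c w)
  have "mword (tau_word 0 w) \<in> QB0"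
    unfolding QB0_def using tau_word_last[of 0 w] by (intro QV.span_base) auto
  then show ?case by (simp add: tau_def lin_scale QB0_def QV.span_scale)
next
  case (add x y)
  then show ?case by (simp add: tau_def lin_add QB0_def QV.span_add)
qed

lemma last_y_append [simp]: "last_y (p @ a # q) = last_y (a # q)"
  by (induction p) auto

text \<open>The trailing letters \<open>b_0\<close> of \<open>w\<close> merge into the appended
  block, so \<open>z\<close> becomes \<open>fst a\<close>.\<close>

lemma eval_word_snoc_block:
  "eval_word (w @ replicate n 0 @ [Suc m]) (ws @ [a]) 0 = eval_word w ws (fst a) * fst a ^ n * snd a ^ m"
proof (induction w arbitrary: ws)
  case Nil
  then show ?case
    by (cases ws) (auto simp: eval_word_replicate_zero split: list.split)
next
  case (Cons i w)
  have "eval_word (u @ replicate n 0 @ [Suc m]) [] 0 = 0" for u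
    by (induction u) (auto simp: eval_word_replicate_zero)
  with Cons.IH[of ws] Cons.IH[of "tl ws"] show ?case by (cases ws) simp_all
qed

lemma eval_word_const: "w = [] \<or> last w \<noteq> 0 \<Longrightarrow> eval_word w ws z = eval_word w ws 0"
  using ex_block_word[of w] by (auto simp: eval_block_word)

text \<open>\<open>tau\<close> reverses the blocks and exchanges the exponents \<open>m\<close> and
  \<open>n\<close> of each of them, which is undone by reversing the points and swapping their
  coordinates.\<close>

lemma eval_tau_block_word:
  "eval_word (tau_word 0 (block_word bs)) (swap_rev ws) 0 = block_mon bs ws"
proof (induction bs ws rule: block_mon.induct)
  case (1 m n bs a ws)
  let ?t = "tau_word 0 (block_word bs)"
  have "tau_word 0 (block_word ((m, n) # bs)) = ?t @ replicate n 0 @ [Suc m]"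
    using tau_word_block[of "Suc n" 0 m "block_word bs"] by simp
  then have "eval_word (tau_word 0 (block_word ((m, n) # bs))) (swap_rev (a # ws)) 0
      = eval_word ?t (swap_rev ws) (snd a) * snd a ^ n * fst a ^ m"
    using eval_word_snoc_block[of ?t n m "swap_rev ws" "prod.swap a"] by simp
  also have "eval_word ?t (swap_rev ws) (snd a) = block_mon bs ws"
    using eval_word_const[OF tau_word_last, of 0 "block_word bs" "swap_rev ws" "snd a"] 1 by simp
  finally show ?case by simp
next
  case ("3_2" b bs)
  obtain m n where b: "b = (m, n)" by (cases b)
  have "eval_word (w @ replicate n 0 @ [Suc m]) [] 0 = 0" for w
    by (induction w) (auto simp: eval_word_replicate_zero)
  then show ?case
    using tau_word_block[of "Suc n" 0 m "block_word bs"] by (simp add: b)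
qed auto

lemma ev_tau:
  assumes "x \<in> QB0"
  shows "ev (tau x) ws 0 = ev x (swap_rev ws) 0"
  using assms unfolding QB0_def
proof (induction rule: QV.span_induct_alt)
  case base
  show ?case by (simp add: tau_def)
next
  case (step c x y)
  then obtain w where w: "x = mword w" "w = [] \<or> last w \<noteq> 0" by auto
  then obtain bs where bs: "w = block_word bs" using ex_block_word by blast
  have "eval_word (tau_word 0 w) ws 0 = eval_word w (swap_rev ws) 0"
    using eval_tau_block_word[of bs "swap_rev ws"] by (simp add: bs eval_block_word rev_map)
  with step w show ?case by (simp add: tau_def lin_add lin_scale ev_add ev_scale)
qed

section \<open>Evaluation of Lie elements\<close>

abbreviation translate :: "rat \<times> rat \<Rightarrow> (rat \<times> rat) list \<Rightarrow> (rat \<times> rat) list" where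
  "translate c ws \<equiv> map (\<lambda>w. w - c) ws"

lemma head_x_translate: "head_x (translate (t, s) ws) (z - t) = head_x ws z - t"
  by (cases ws) auto

lemma lookup_mult_singleton:
  "Poly_Mapping.lookup (x * y) [a] = Poly_Mapping.lookup x [] * Poly_Mapping.lookup y [a]
    + Poly_Mapping.lookup x [a] * Poly_Mapping.lookup y []"
  for x y :: QB
proof (induction x rule: QB_induct)
  case (scale c u)
  show ?case
  proof (induction y rule: QB_induct)
    case (scale d v)
    show ?case
      by (auto simp: scale_mult_left scale_mult_right mword_mult lookup_mword Cons_eq_append_conv)
  next
    case (add x y)
    then show ?case by (simp add: distrib_left lookup_add)
  qed
next
  case (add x y)
  then show ?case by (simp add: distrib_right lookup_add)
qed

lemma Lie_B_ev_Nil: "\<psi> \<in> Lie_B \<Longrightarrow> ev \<psi> [] z = Poly_Mapping.lookup \<psi> [0] * z"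
proof (induction rule: Lie_B.induct)
  case (letter i)
  show ?case by (simp add: lookup_mword)
next
  case (bracket x y)
  then show ?case
    by (simp add: lie_bracket_def ev_minus ev_mult lookup_minus lookup_mult_singleton)
qed (simp_all add: ev_add ev_scale lookup_add distrib_right)

text \<open>Only an empty factor, which evaluates to a multiple of its \<open>z\<close>, changes
  under the shift. The resulting defect is symmetric in \<open>x\<close> and
  \<open>y\<close>.\<close>

lemma ev_mult_translate:
  assumes Nil: "\<And>z. ev x [] z = c * z" "\<And>z. ev y [] z = d * z"
    and x: "\<And>ws z. ws \<noteq> [] \<Longrightarrow> ev x (translate (t, 0) ws) (z - t) = ev x ws z"
    and y: "\<And>ws z. ws \<noteq> [] \<Longrightarrow> ev y (translate (t, 0) ws) (z - t) = ev y ws z"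
    and ws: "ws \<noteq> []"
  shows "ev (x * y) (translate (t, 0) ws) (z - t) = ev (x * y) ws z - t * c * ev y ws z - t * d * ev x ws z"
proof -
  have "ev (x * y) (translate (t, 0) ws) (z - t)
      = split_sum (\<lambda>p q. ev x p (head_x q z) * ev y q z - (if p = [] then t * c * ev y q z else 0)
          - (if q = [] then t * d * ev x p z else 0)) ws"
    unfolding ev_mult split_sum_map head_x_translate
  proof (rule split_sum_cong)
    fix p q assume pq: "p @ q = ws"
    show "ev x (translate (t, 0) p) (head_x q z - t) * ev y (translate (t, 0) q) (z - t)
        = ev x p (head_x q z) * ev y q z - (if p = [] then t * c * ev y q z else 0)
          - (if q = [] then t * d * ev x p z else 0)"
      using pq ws x y by (cases "p = []"; cases "q = []") (auto simp: Nil algebra_simps)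
  qed
  then show ?thesis
    by (simp add: split_sum_diff split_sum_Nil_left split_sum_Nil_right ev_mult)
qed

text \<open>The shift substitutes \<open>b_0 - t\<close> for \<open>b_0\<close>, and the scalar
  \<open>t\<close> drops out of every bracket; formally, the defects in
  \<open>ev_mult_translate\<close> cancel.\<close>

lemma Lie_B_ev_translate:
  assumes "\<psi> \<in> Lie_B" "ws \<noteq> []"
  shows "ev \<psi> (translate (t, 0) ws) (z - t) = ev \<psi> ws z"
  using assms
proof (induction arbitrary: ws z rule: Lie_B.induct)
  case (letter i)
  then show ?case by (cases ws) auto
next
  case (bracket x y)
  note prod = ev_mult_translate[OF Lie_B_ev_Nil[OF bracket.hyps(1)] Lie_B_ev_Nil[OF bracket.hyps(2)]
      bracket.IH bracket.prems]
    ev_mult_translate[OF Lie_B_ev_Nil[OF bracket.hyps(2)] Lie_B_ev_Nil[OF bracket.hyps(1)]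
      bracket.IH(2,1) bracket.prems]
  show ?case by (simp add: lie_bracket_def ev_minus prod)
qed (simp_all add: ev_add ev_scale)

text \<open>Reversing a word attaches each run of \<open>b_0\<close> to the neighbouring letter, so
  \<open>y_i\<close> is paired with \<open>x_(i+1)\<close>. The minus sign is the antipode sign of
  the letters \<open>b_0\<close>; the other letters give the factor \<open>(-1) ^ length ws\<close>
  in the lemmas below.\<close>

fun reflect :: "(rat \<times> rat) list \<Rightarrow> rat \<Rightarrow> (rat \<times> rat) list" where
  "reflect [] z = []"
| "reflect (a # ws) z = reflect ws z @ [(- head_x ws z, snd a)]"

lemma split_sum_reflect:
  "split_sum f (reflect ws z) = split_sum (\<lambda>p q. f (reflect q z) (reflect p (head_x q z))) ws"
proof (induction ws arbitrary: f)
  case (Cons a ws)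
  have "split_sum (\<lambda>p q. f (reflect q z) (reflect p (head_x q z) @ [(- head_x ws z, snd a)])) ws
      = split_sum (\<lambda>p q. f (reflect q z) (reflect (a # p) (head_x q z))) ws"
    by (rule split_sum_cong) auto
  then show ?case by (simp add: split_sum_snoc Cons add.commute)
qed simp

lemma length_reflect: "length (reflect ws z) = length ws"
  by (induction ws) auto

lemma head_x_reflect: "head_x (reflect ws z) (- head_x ws z) = - z"
  by (induction ws) auto

text \<open>The antipode reverses products and the two minus signs cancel, so \<open>x * y\<close>
  goes to \<open>y * x\<close> and a bracket changes sign.\<close>

lemma ev_mult_reflect:
  assumes x: "\<And>ws z. ev x (reflect ws z) (- head_x ws z) = - ((-1) ^ length ws * ev x ws z)"
    and y: "\<And>ws z. ev y (reflect ws z) (- head_x ws z) = - ((-1) ^ length ws * ev y ws z)"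
  shows "ev (x * y) (reflect ws z) (- head_x ws z) = (-1) ^ length ws * ev (y * x) ws z"
proof -
  have "ev (x * y) (reflect ws z) (- head_x ws z)
      = split_sum (\<lambda>p q. (-1) ^ length ws * (ev y p (head_x q z) * ev x q z)) ws"
    unfolding ev_mult split_sum_reflect
  proof (rule split_sum_cong)
    fix p q assume pq: "p @ q = ws"
    have h: "head_x ws z = head_x p (head_x q z)" using pq by auto
    have "ev x (reflect q z) (head_x (reflect p (head_x q z)) (- head_x ws z)) *
        ev y (reflect p (head_x q z)) (- head_x ws z)
      = ev x (reflect q z) (- head_x q z) * ev y (reflect p (head_x q z)) (- head_x p (head_x q z))"
      unfolding h head_x_reflect ..
    also have "\<dots> = (-1) ^ length ws * (ev y p (head_x q z) * ev x q z)"
      using pq by (auto simp: x y power_add)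
    finally show "ev x (reflect q z) (head_x (reflect p (head_x q z)) (- head_x ws z)) *
        ev y (reflect p (head_x q z)) (- head_x ws z)
      = (-1) ^ length ws * (ev y p (head_x q z) * ev x q z)" .
  qed
  then show ?thesis by (simp add: split_sum_mult_left ev_mult)
qed

text \<open>This is the relation \<open>S \<psi> = - \<psi>\<close> for the antipode \<open>S\<close>.\<close>

lemma Lie_B_ev_reflect:
  "\<psi> \<in> Lie_B \<Longrightarrow> ev \<psi> (reflect ws z) (- head_x ws z) = - ((-1) ^ length ws * ev \<psi> ws z)"
proof (induction arbitrary: ws z rule: Lie_B.induct)
  case (letter i)
  show ?case
  proof (cases "depth [i] = length ws")
    case True
    then show ?thesis by (cases ws; cases "tl ws") (auto split: if_splits)
  next
    case False
    then show ?thesis by (simp add: eval_word_eq_0 length_reflect del: eval_word.simps)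
  qed
next
  case (bracket x y)
  show ?case
    using ev_mult_reflect[of x y ws z, OF bracket.IH] ev_mult_reflect[of y x ws z, OF bracket.IH(2,1)]
    by (simp add: lie_bracket_def ev_minus right_diff_distrib)
qed (simp_all add: ev_add ev_scale distrib_left)

text \<open>
  In the coordinates \<open>x\<^sub>i - x\<^sub>i\<^sub>+\<^sub>1\<close> (with \<open>x\<^sub>d\<^sub>+\<^sub>1 = z\<close>), this sum inserts the pair \<open>(- t, y)\<close> at all
  positions of \<open>ws\<close>, that is, it shuffles \<open>ws\<close> with one letter.
\<close>

definition insert_sum :: "QB \<Rightarrow> rat \<Rightarrow> rat \<Rightarrow> (rat \<times> rat) list \<Rightarrow> rat \<Rightarrow> rat" where
  "insert_sum \<psi> t y ws z = split_sum (\<lambda>p q. ev \<psi> (translate (t, 0) p @ (head_x q z - t, y) # q) z) ws"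

text \<open>The new point lands in one of the two factors. If that factor has further points, the
  sum over its positions vanishes by hypothesis; only the two boundary terms, where the new point is
  alone in its factor, survive.\<close>

lemma insert_sum_mult:
  assumes x: "\<And>ws z. ws \<noteq> [] \<Longrightarrow> insert_sum a t y ws z = 0"
    and y: "\<And>ws z. ws \<noteq> [] \<Longrightarrow> insert_sum b t y ws z = 0"
    and a: "\<And>ws z. ws \<noteq> [] \<Longrightarrow> ev a (translate (t, 0) ws) (z - t) = ev a ws z"
    and ws: "ws \<noteq> []"
  shows "insert_sum (a * b) t y ws z
    = ev a ws z * ev b [(z - t, y)] z + ev a [(head_x ws z - t, y)] (head_x ws z) * ev b ws z"
proof -
  \<comment> \<open>In \<open>f\<close> the new point lies in the second factor, so the whole first
    factor is shifted by \<open>t\<close>; in \<open>g\<close> it lies in the first factor and the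
    second is unshifted.\<close>
  define f where "f p1 p2 q = ev a (translate (t, 0) p1) (head_x (p2 @ q) z - t)
      * ev b (translate (t, 0) p2 @ (head_x q z - t, y) # q) z" for p1 p2 q
  define g where "g p q1 q2 = ev a (translate (t, 0) p @ (head_x q1 (head_x q2 z) - t, y) # q1) (head_x q2 z)
      * ev b q2 z" for p q1 q2
  have "insert_sum (a * b) t y ws z
      = split_sum (\<lambda>p q. split_sum (\<lambda>p1 p2. f p1 p2 q) p + split_sum (g p) q) ws"
    unfolding insert_sum_def ev_mult split_sum_append_Cons split_sum_map
  proof (intro split_sum_cong arg_cong2[where f = "(+)"])
    fix p q p1 p2 :: "(rat \<times> rat) list" assume "p1 @ p2 = p"
    show "ev a (translate (t, 0) p1) (head_x (translate (t, 0) p2 @ (head_x q z - t, y) # q) z)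
        * ev b (translate (t, 0) p2 @ (head_x q z - t, y) # q) z = f p1 p2 q"
      by (simp add: f_def head_x_translate)
  next
    fix p q q1 q2 :: "(rat \<times> rat) list" assume "q1 @ q2 = q"
    then show "ev a (translate (t, 0) p @ (head_x q z - t, y) # q1) (head_x q2 z) * ev b q2 z = g p q1 q2"
      by (auto simp: g_def)
  qed
  also have "\<dots> = split3_sum f ws + split3_sum g ws"
    by (simp add: split_sum_add split_sum_assoc) (simp add: split3_sum_def)
  also have "split3_sum f ws = split_sum (\<lambda>p1 r. if r = [] then ev a p1 z * ev b [(z - t, y)] z else 0) ws"
    unfolding split3_sum_def
  proof (rule split_sum_cong)
    fix p1 r assume r: "p1 @ r = ws"
    have "split_sum (f p1) r = ev a (translate (t, 0) p1) (head_x r z - t) * insert_sum b t y r z"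
      unfolding insert_sum_def split_sum_mult_left[symmetric]
      by (rule split_sum_cong) (auto simp: f_def)
    then show "split_sum (f p1) r = (if r = [] then ev a p1 z * ev b [(z - t, y)] z else 0)"
      using y r ws a[of p1 z] by (auto simp: insert_sum_def)
  qed
  also have "split3_sum g ws = split_sum (\<lambda>r q. if r = []
      then ev a [(head_x q z - t, y)] (head_x q z) * ev b q z else 0) ws"
    unfolding split_sum_assoc[symmetric]
  proof (rule split_sum_cong)
    fix r q assume "r @ q = ws"
    have "split_sum (\<lambda>p q1. g p q1 q) r = insert_sum a t y r (head_x q z) * ev b q z"
      unfolding insert_sum_def split_sum_mult_right[symmetric] g_def ..
    then show "split_sum (\<lambda>p q1. g p q1 q) r
        = (if r = [] then ev a [(head_x q z - t, y)] (head_x q z) * ev b q z else 0)"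
      using x by (auto simp: insert_sum_def)
  qed
  finally show ?thesis by (simp add: split_sum_Nil_left split_sum_Nil_right)
qed

lemma Lie_B_insert_sum:
  assumes "\<psi> \<in> Lie_B" "ws \<noteq> []"
  shows "insert_sum \<psi> t y ws z = 0"
  using assms
proof (induction arbitrary: ws z rule: Lie_B.induct)
  case (letter i)
  have "eval_word [i] (translate (t, 0) p @ (head_x q z - t, y) # q) z = 0" if "p @ q = ws" for p q
    using that letter by (cases p; cases q; cases "tl p") auto
  then have "insert_sum (mword [i]) t y ws z = split_sum (\<lambda>p q. 0) ws"
    unfolding insert_sum_def by (intro split_sum_cong) simp
  then show ?case by simp
next
  case (bracket a b)
  \<comment> \<open>Values at a single point do not depend on the head, so the boundary terms for
    \<open>a * b\<close> and \<open>b * a\<close> coincide and cancel in the bracket.\<close>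
  have single: "ev c [(h - t, y)] h = ev c [(- t, y)] 0" if "c \<in> Lie_B" for c h
    using Lie_B_ev_translate[OF that, of "[(h - t, y)]" h h] by simp
  have minus: "insert_sum (u - v) t y ws z = insert_sum u t y ws z - insert_sum v t y ws z" for u v
    by (simp add: insert_sum_def ev_minus split_sum_diff)
  show ?case
    using insert_sum_mult[OF bracket.IH Lie_B_ev_translate[OF bracket.hyps(1)] bracket.prems, of z]
      insert_sum_mult[OF bracket.IH(2,1) Lie_B_ev_translate[OF bracket.hyps(2)] bracket.prems, of z]
      single[OF bracket.hyps(1)] single[OF bracket.hyps(2)]
    by (simp add: lie_bracket_def minus)
qed (simp_all add: insert_sum_def ev_add ev_scale split_sum_add split_sum_mult_left)

section \<open>Evaluation of \<open>\<sigma>\<^sub>\<psi>\<close>\<close>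

lemma below_Nil: "below [] = {[]}"
  by (auto simp: below_def)

lemma below_Cons: "below (k # ks) = (\<lambda>(l, ls). l # ls) ` ({1..k} \<times> below ks)"
proof (intro equalityI subsetI)
  fix l assume l: "l \<in> below (k # ks)"
  then obtain l0 ls where [simp]: "l = l0 # ls" by (auto simp: below_def length_Suc_conv)
  have "1 \<le> ls ! i \<and> ls ! i \<le> ks ! i" if "i < length ks" for i
    using l that by (auto simp: below_def dest!: spec[of _ "Suc i"])
  moreover have "1 \<le> l0 \<and> l0 \<le> k"
    using l by (auto simp: below_def dest!: spec[of _ 0])
  ultimately show "l \<in> (\<lambda>(l, ls). l # ls) ` ({1..k} \<times> below ks)"
    using l by (auto simp: below_def)
next
  fix l assume "l \<in> (\<lambda>(l, ls). l # ls) ` ({1..k} \<times> below ks)"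
  then show "l \<in> below (k # ks)"
    by (auto simp: below_def nth_Cons split: nat.split)
qed

lemma sum_below_Cons:
  "(\<Sum>l\<in>below (k # ks). g l) = (\<Sum>l=1..k. \<Sum>ls\<in>below ks. g (l # ls) :: rat)"
  unfolding below_Cons
  by (subst sum.reindex) (auto simp: inj_on_def sum.cartesian_product case_prod_unfold)

lemma sum_list_below: "l \<in> below k \<Longrightarrow> sum_list l \<le> sum_list k"
proof (induction k arbitrary: l)
  case (Cons k ks)
  then obtain l0 ls where l: "l = l0 # ls" "l0 \<le> k" "ls \<in> below ks" by (auto simp: below_Cons)
  with Cons.IH[of ls] show ?case by simp
qed (simp add: below_Nil)

lemma binom_tuple_Cons:
  "binom_tuple (k # ks) (l # ls) = ((k - 1) choose (l - 1)) * binom_tuple ks ls"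
  by (simp add: binom_tuple_def prod.lessThan_Suc_shift del: prod.lessThan_Suc)

text \<open>The sum factors over the letters other than \<open>b_0\<close>, and for each of them the
  binomial theorem gives \<open>(y - Y) ^ (k - 1)\<close>.\<close>

lemma eval_subst_idx_sum:
  "(\<Sum>l\<in>below (idx w). (- Y) ^ (sum_list (idx w) - sum_list l) * of_nat (binom_tuple (idx w) l)
      * eval_word (subst_idx w l) ws z) = eval_word w (translate (0, Y) ws) z"
proof (induction w arbitrary: ws)
  case Nil
  show ?case by (simp add: idx_def below_Nil binom_tuple_def)
next
  case (Cons k w)
  show ?case
  proof (cases "k = 0")
    case True
    have "head_x (translate (0, Y) ws) z = head_x ws z"
      using head_x_translate[of 0 Y ws z] by simp
    moreover have "idx (k # w) = idx w" using True by (simp add: idx_def)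
    ultimately show ?thesis
      using True by (simp add: Cons[symmetric] sum_distrib_left mult.left_commute)
  next
    case False
    have idx: "idx (k # w) = k # idx w" using False by (simp add: idx_def)
    show ?thesis
    proof (cases ws)
      case Nil
      have "eval_word (subst_idx (k # w) l) ws z = 0" if l: "l \<in> below (k # idx w)" for l
        using l False Nil by (auto simp: below_Cons)
      then show ?thesis using False Nil by (simp add: idx)
    next
      case (Cons a ws')
      have "(\<Sum>l\<in>below (idx (k # w)). (- Y) ^ (sum_list (idx (k # w)) - sum_list l)
            * of_nat (binom_tuple (idx (k # w)) l) * eval_word (subst_idx (k # w) l) ws z)
          = (\<Sum>l=1..k. \<Sum>ls\<in>below (idx w). (of_nat ((k - 1) choose (l - 1)) * snd a ^ (l - 1) * (- Y) ^ (k - l))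
            * ((- Y) ^ (sum_list (idx w) - sum_list ls) * of_nat (binom_tuple (idx w) ls)
              * eval_word (subst_idx w ls) ws' z))"
        unfolding idx sum_below_Cons
      proof (intro sum.cong refl)
        fix l ls assume l: "l \<in> {1..k}" and ls: "ls \<in> below (idx w)"
        have "k + sum_list (idx w) - (l + sum_list ls) = (k - l) + (sum_list (idx w) - sum_list ls)"
          using l sum_list_below[OF ls] by simp
        then have "(- Y) ^ (sum_list (k # idx w) - sum_list (l # ls))
            = (- Y) ^ (k - l) * (- Y) ^ (sum_list (idx w) - sum_list ls)"
          by (simp only: sum_list.Cons power_add)
        then show "(- Y) ^ (sum_list (k # idx w) - sum_list (l # ls))
              * of_nat (binom_tuple (k # idx w) (l # ls)) * eval_word (subst_idx (k # w) (l # ls)) ws z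
            = (of_nat ((k - 1) choose (l - 1)) * snd a ^ (l - 1) * (- Y) ^ (k - l))
              * ((- Y) ^ (sum_list (idx w) - sum_list ls) * of_nat (binom_tuple (idx w) ls)
                * eval_word (subst_idx w ls) ws' z)"
          using False l by (simp add: Cons binom_tuple_Cons mult_ac)
      qed
      also have "\<dots> = (\<Sum>l=1..k. of_nat ((k - 1) choose (l - 1)) * snd a ^ (l - 1) * (- Y) ^ (k - l))
          * eval_word w (translate (0, Y) ws') z"
        by (simp add: sum_product Cons.IH[symmetric])
      also have "(\<Sum>l=1..k. of_nat ((k - 1) choose (l - 1)) * snd a ^ (l - 1) * (- Y) ^ (k - l))
          = (\<Sum>l\<le>k - 1. of_nat ((k - 1) choose l) * snd a ^ l * (- Y) ^ (k - 1 - l))"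
        by (rule sum.reindex_bij_witness[where i = Suc and j = "\<lambda>l. l - 1"]) (use False in auto)
      also have "\<dots> = (snd a + - Y) ^ (k - 1)"
        by (simp only: binomial_ring)
      finally show ?thesis using False by (simp add: Cons)
    qed
  qed
qed

lemma eval_word_snoc:
  "eval_word (w @ [Suc m]) ws z
    = (if ws = [] then 0 else eval_word w (butlast ws) (fst (last ws)) * snd (last ws) ^ m)"
proof (induction w arbitrary: ws)
  case Nil
  then show ?case by (cases ws; cases "tl ws") auto
next
  case (Cons i w)
  have "head_x (butlast ws) (fst (last ws)) = head_x ws z" if "ws \<noteq> []"
    using that by (cases ws; cases "tl ws") auto
  then show ?case
    using Cons by (cases ws; cases "tl ws") (auto simp: mult.assoc)
qed

text \<open>Since \<open>sum_list l \<le> sum_list (idx w)\<close>, the sum in the sign has the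
  parity of the difference, and the truncated subtraction in the index is exact.\<close>

lemma partial_gen_signed:
  assumes "0 < i"
  shows "ev (partial_gen w i) ws z = (\<Sum>l\<in>below (idx w).
      (- 1) ^ (sum_list (idx w) - sum_list l) * of_nat (binom_tuple (idx w) l)
        * (eval_word ((i + (sum_list (idx w) - sum_list l)) # subst_idx w l) ws z
          - eval_word (subst_idx w l @ [i + (sum_list (idx w) - sum_list l)]) ws z))"
proof -
  have "(-1 :: rat) ^ (sum_list (idx w) + sum_list l) = (- 1) ^ (sum_list (idx w) - sum_list l)
      \<and> i + sum_list (idx w) - sum_list l = i + (sum_list (idx w) - sum_list l)"
    if "l \<in> below (idx w)" for l
    using sum_list_below[OF that] by (simp add: power_add[symmetric] minus_one_power_iff)
  then show ?thesis
    using assms unfolding partial_gen_def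
    by (auto simp: ev_sum ev_scale lie_bracket_def ev_minus mword_mult intro!: sum.cong)
qed

text \<open>The raised index contributes the missing power of the coordinate \<open>y\<close> of
  that letter. With the sign it becomes a power of \<open>- y\<close>, so
  \<open>eval_subst_idx_sum\<close> applies with \<open>Y = y\<close>: first or last point,
  according to the side of the commutator.\<close>

lemma ev_partial_gen_Cons:
  assumes "0 < i"
  shows "ev (partial_gen w i) (a # ws) z = snd a ^ (i - 1) * eval_word w (translate (0, snd a) ws) z
    - eval_word w (translate (0, snd (last (a # ws))) (butlast (a # ws))) (fst (last (a # ws)))
      * snd (last (a # ws)) ^ (i - 1)"
proof -
  let ?e = "\<lambda>l. sum_list (idx w) - sum_list l"
  let ?b = "last (a # ws)"
  obtain j where j: "i = Suc j" using assms by (cases i) auto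
  have "ev (partial_gen w i) (a # ws) z
      = (\<Sum>l\<in>below (idx w). snd a ^ j * ((- snd a) ^ ?e l * of_nat (binom_tuple (idx w) l)
            * eval_word (subst_idx w l) ws z)
          - snd ?b ^ j * ((- snd ?b) ^ ?e l * of_nat (binom_tuple (idx w) l)
            * eval_word (subst_idx w l) (butlast (a # ws)) (fst ?b)))"
    unfolding partial_gen_signed[OF assms]
  proof (rule sum.cong[OF refl])
    fix l assume "l \<in> below (idx w)"
    have "eval_word (subst_idx w l @ [i + ?e l]) (a # ws) z
        = eval_word (subst_idx w l) (butlast (a # ws)) (fst ?b) * snd ?b ^ (j + ?e l)"
      using eval_word_snoc[of "subst_idx w l" "j + ?e l" "a # ws" z] j by simp
    moreover have "eval_word ((i + ?e l) # subst_idx w l) (a # ws) z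
        = snd a ^ (j + ?e l) * eval_word (subst_idx w l) ws z"
      using j by simp
    ultimately show "(- 1) ^ ?e l * of_nat (binom_tuple (idx w) l)
        * (eval_word ((i + ?e l) # subst_idx w l) (a # ws) z - eval_word (subst_idx w l @ [i + ?e l]) (a # ws) z)
      = snd a ^ j * ((- snd a) ^ ?e l * of_nat (binom_tuple (idx w) l) * eval_word (subst_idx w l) ws z)
        - snd ?b ^ j * ((- snd ?b) ^ ?e l * of_nat (binom_tuple (idx w) l)
          * eval_word (subst_idx w l) (butlast (a # ws)) (fst ?b))"
      by (simp only: power_minus[of "snd a"] power_minus[of "snd ?b"] power_add right_diff_distrib mult_ac)
  qed
  also have "\<dots> = snd a ^ j * eval_word w (translate (0, snd a) ws) z
      - snd ?b ^ j * eval_word w (translate (0, snd ?b) (butlast (a # ws))) (fst ?b)"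
    by (simp only: sum_subtractf sum_distrib_left[symmetric] eval_subst_idx_sum)
  finally show ?thesis by (simp only: j diff_Suc_1 mult.commute)
qed

lemma ev_partial_gen_Nil: "ev (partial_gen w i) [] z = 0"
proof (cases "0 < i")
  case True
  then obtain j where "i = Suc j" by (cases i) auto
  with True show ?thesis
    by (simp add: partial_gen_signed eval_word_snoc)
qed (simp add: partial_gen_def)

text \<open>
  The two summands of the commutators \<open>[b\<^sub>i, w]\<close> that replace a letter \<open>b\<^sub>i\<close>: in the first one \<open>w\<close> is
  inserted behind the last letter of the first part, in the second one before the letter of the last
  point of the middle part.
\<close>

definition insert_after ::
  "((rat \<times> rat) list \<Rightarrow> rat \<Rightarrow> rat) \<Rightarrow> ((rat \<times> rat) list \<Rightarrow> rat) \<Rightarrow> rat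
    \<Rightarrow> (rat \<times> rat) list \<Rightarrow> (rat \<times> rat) list \<Rightarrow> (rat \<times> rat) list \<Rightarrow> rat" where
  "insert_after F G z p u q = (if p = [] then 0 else F (translate (0, last_y p) u) (head_x q z) * G (p @ q))"

definition insert_before ::
  "((rat \<times> rat) list \<Rightarrow> rat \<Rightarrow> rat) \<Rightarrow> ((rat \<times> rat) list \<Rightarrow> rat)
    \<Rightarrow> (rat \<times> rat) list \<Rightarrow> (rat \<times> rat) list \<Rightarrow> (rat \<times> rat) list \<Rightarrow> rat" where
  "insert_before F G p u q = (if u = [] then 0
     else F (translate (0, snd (last u)) (butlast u)) (fst (last u)) * G (p @ (fst (hd u), snd (last u)) # q))"

text \<open>Leibniz rule by induction on \<open>v\<close>: a leading \<open>b_0\<close> is a common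
  factor because both insertions keep the first x-coordinate; for another leading letter,
  differentiating it yields the insertions next to the first point.\<close>

lemma ev_deriv_word:
  "ev (deriv_word (partial_gen w) v) ws z = split3_sum (\<lambda>p u q.
      insert_after (eval_word w) (\<lambda>ws. eval_word v ws z) z p u q
      - insert_before (eval_word w) (\<lambda>ws. eval_word v ws z) p u q) ws"
proof (induction v arbitrary: ws)
  case Nil
  have "split3_sum (\<lambda>p u q. insert_after (eval_word w) (\<lambda>ws. eval_word [] ws z) z p u q
      - insert_before (eval_word w) (\<lambda>ws. eval_word [] ws z) p u q) ws = split3_sum (\<lambda>p u q. 0) ws"
    by (rule split3_sum_cong) (simp add: insert_after_def insert_before_def)
  then show ?case by (simp add: split3_sum_def)
next
  case (Cons i v)
  let ?D = "\<lambda>v p u q. insert_after (eval_word w) (\<lambda>ws. eval_word v ws z) z p u q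
      - insert_before (eval_word w) (\<lambda>ws. eval_word v ws z) p u q"
  show ?case
  proof (cases "i = 0")
    case True
    have "split3_sum (?D (i # v)) ws = split3_sum (\<lambda>p u q. head_x ws z * ?D v p u q) ws"
    proof (rule split3_sum_cong)
      fix p u q assume "p @ u @ q = ws"
      then have "head_x (p @ q) z = head_x ws z" if "p \<noteq> []"
        using that by (cases p) auto
      moreover have "head_x (p @ (fst (hd u), snd (last u)) # q) z = head_x ws z" if "u \<noteq> []"
        using that \<open>p @ u @ q = ws\<close> by (cases p; cases u) auto
      ultimately show "?D (i # v) p u q = head_x ws z * ?D v p u q"
        using True by (simp add: insert_after_def insert_before_def right_diff_distrib)
    qed
    moreover have "ev (letter 0 * x) ws z = head_x ws z * ev x ws z" for x
    proof -
      have "ev (letter 0 * x) ws z = split_sum (\<lambda>p q. if p = [] then head_x q z * ev x q z else 0) ws"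
        unfolding ev_mult by (rule split_sum_cong) (auto split: list.split)
      then show ?thesis by (simp add: split_sum_Nil_left)
    qed
    ultimately show ?thesis
      using True Cons by (simp add: partial_gen_def split3_sum_mult_left)
  next
    case False
    show ?thesis
    proof (cases ws)
      case Nil
      then show ?thesis
        using False by (simp add: ev_add ev_mult ev_partial_gen_Nil split3_sum_def insert_after_def insert_before_def)
    next
      case ws: (Cons a ws')
      \<comment> \<open>The term in which \<open>w\<close> is inserted directly behind the first
        letter, that is \<open>p = [a]\<close> in the sum over \<open>ws\<close>.\<close>
      let ?A = "\<lambda>u q. snd a ^ (i - 1) * eval_word w (translate (0, snd a) u) (head_x q z) * eval_word v q z"
      have l: "ev (letter i * deriv_word (partial_gen w) v) ws z = split3_sum (\<lambda>p u q. snd a ^ (i - 1) * ?D v p u q) ws'"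
      proof -
        have "ev (letter i * deriv_word (partial_gen w) v) ws z
            = split_sum (\<lambda>p q. if p = [] then snd a ^ (i - 1) * ev (deriv_word (partial_gen w) v) q z else 0) ws'"
          using False unfolding ws ev_mult
          by (simp, intro split_sum_cong) simp
        then show ?thesis by (simp add: split_sum_Nil_left Cons split3_sum_mult_left)
      qed
      have g: "ev (partial_gen w i * mword v) ws z
          = split_sum ?A ws' - split_sum (insert_before (eval_word w) (\<lambda>ws. eval_word (i # v) ws z) []) ws"
      proof -
        have "ev (partial_gen w i * mword v) ws z
            = split_sum (\<lambda>p q. ?A p q - insert_before (eval_word w) (\<lambda>ws. eval_word (i # v) ws z) [] (a # p) q) ws'"
          unfolding ws ev_mult
          by (simp add: ev_partial_gen_Nil, intro split_sum_cong)
            (use False in \<open>simp add: ev_partial_gen_Cons insert_before_def left_diff_distrib right_diff_distrib mult_ac\<close>)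
        moreover have "insert_before F G [] [] q = 0" for F G and q :: "(rat \<times> rat) list"
          by (simp add: insert_before_def)
        ultimately show ?thesis by (simp add: ws split_sum_diff del: eval_word.simps)
      qed
      have "split3_sum (?D (i # v)) ws
          = split_sum (\<lambda>u q. - insert_before (eval_word w) (\<lambda>ws. eval_word (i # v) ws z) [] u q) ws
            + split3_sum (\<lambda>p. ?D (i # v) (a # p)) ws'"
        unfolding ws split3_sum_Cons by (simp add: insert_after_def)
      also have "split3_sum (\<lambda>p. ?D (i # v) (a # p)) ws'
          = split3_sum (\<lambda>p u q. (if p = [] then ?A u q else 0) + snd a ^ (i - 1) * ?D v p u q) ws'"
        by (rule split3_sum_cong)
          (use False in \<open>auto simp: insert_after_def insert_before_def algebra_simps\<close>)
      also have "\<dots> = split_sum ?A ws' + split3_sum (\<lambda>p u q. snd a ^ (i - 1) * ?D v p u q) ws'"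
      proof -
        have "split3_sum (\<lambda>p u q. if p = [] then ?A u q else 0) ws'
            = split_sum (\<lambda>p r. if p = [] then split_sum ?A r else 0) ws'"
          unfolding split3_sum_def by (rule split_sum_cong) simp
        then show ?thesis by (simp add: split3_sum_add split_sum_Nil_left)
      qed
      finally show ?thesis
        by (simp add: ev_add l g split_sum_uminus)
    qed
  qed
qed

lemma ev_partial:
  "ev (partial \<psi> x) ws z = split3_sum (\<lambda>p u q.
      insert_after (ev \<psi>) (\<lambda>ws. ev x ws z) z p u q - insert_before (ev \<psi>) (\<lambda>ws. ev x ws z) p u q) ws"
proof (induction \<psi> rule: QB_induct)
  case (scale c w)
  show ?case
  proof (induction x rule: QB_induct)
    case (scale d v)
    have "split3_sum (\<lambda>p u q.
        insert_after (ev (Defs.scale c (mword w))) (\<lambda>ws. ev (Defs.scale d (mword v)) ws z) z p u q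
        - insert_before (ev (Defs.scale c (mword w))) (\<lambda>ws. ev (Defs.scale d (mword v)) ws z) p u q) ws
      = split3_sum (\<lambda>p u q. c * d * (insert_after (eval_word w) (\<lambda>ws. eval_word v ws z) z p u q
          - insert_before (eval_word w) (\<lambda>ws. eval_word v ws z) p u q)) ws"
      by (rule split3_sum_cong)
        (simp add: insert_after_def insert_before_def ev_scale right_diff_distrib mult_ac)
    moreover have "ev (partial (Defs.scale c (mword w)) (Defs.scale d (mword v))) ws z
        = c * d * ev (deriv_word (partial_gen w) v) ws z"
      by (simp add: partial_def derivation_of_def lin_scale ev_scale)
    ultimately show ?case
      by (simp only: ev_deriv_word split3_sum_mult_left)
  next
    case (add x y)
    show ?case
      unfolding partial_add ev_add add split3_sum_add[symmetric]
      by (rule split3_sum_cong) (simp add: insert_after_def insert_before_def algebra_simps)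
  qed
next
  case (add x y)
  have "partial (x + y) v = partial x v + partial y v" for v
    by (simp add: partial_def lin_add)
  then show ?case
    unfolding ev_add add split3_sum_add[symmetric]
    by (simp only: ev_add add split3_sum_add[symmetric])
      (rule split3_sum_cong, simp add: insert_after_def insert_before_def ev_add algebra_simps)
qed

text \<open>Left multiplication by \<open>\<psi>\<close> supplies exactly the insertion at the front
  that \<open>insert_after\<close> omits, so the first sum runs over all splittings.\<close>

lemma ev_sigma:
  assumes tr: "\<And>ws t. ev \<psi> ws t = f (translate (t, 0) ws)"
  shows "ev (sigma \<psi> x) ws 0
    = split3_sum (\<lambda>p u q. f (translate (head_x q 0, last_y p) u) * ev x (p @ q) 0) ws
      - split3_sum (\<lambda>p u q. if u = [] then 0 else
          f (translate (last u) (butlast u)) * ev x (p @ (fst (hd u), snd (last u)) # q) 0) ws"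
proof -
  have *: "f (translate (t, 0) (translate (0, s) u)) = f (translate (t, s) u)" for t s u
    by (simp add: comp_def diff_diff_eq)
  have "ev (\<psi> * x) ws 0 = split_sum (\<lambda>p r. if p = []
      then split_sum (\<lambda>u q. f (translate (head_x q 0, 0) u) * ev x q 0) r else 0) ws"
    by (simp add: split_sum_Nil_left ev_mult tr)
  also have "\<dots> = split3_sum (\<lambda>p u q. if p = [] then f (translate (head_x q 0, 0) u) * ev x q 0 else 0) ws"
    unfolding split3_sum_def by (rule split_sum_cong) simp
  finally have "ev (sigma \<psi> x) ws 0 = split3_sum (\<lambda>p u q.
      (if p = [] then f (translate (head_x q 0, 0) u) * ev x q 0 else 0)
      + insert_after (ev \<psi>) (\<lambda>ws. ev x ws 0) 0 p u q - insert_before (ev \<psi>) (\<lambda>ws. ev x ws 0) p u q) ws"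
    by (simp add: sigma_def ev_add ev_partial split3_sum_add split3_sum_minus)
  also have "\<dots> = split3_sum (\<lambda>p u q. f (translate (head_x q 0, last_y p) u) * ev x (p @ q) 0
      - (if u = [] then 0 else
          f (translate (last u) (butlast u)) * ev x (p @ (fst (hd u), snd (last u)) # q) 0)) ws"
    by (rule split3_sum_cong) (simp add: insert_after_def insert_before_def tr * del: map_map)
  finally show ?thesis by (simp only: split3_sum_minus)
qed

section \<open>Push invariance\<close>

text \<open>
  \<open>interlace\<close> is the composition of the antipode with \<open>\<tau>\<close>; applied twice to a cyclic word it rotates
  by one position and negates.
\<close>

fun interlace :: "rat \<Rightarrow> (rat \<times> rat) list \<Rightarrow> (rat \<times> rat) list" where
  "interlace c [] = []"
| "interlace c (a # ws) = (- c, fst a) # interlace (snd a) ws"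

lemma length_interlace [simp]: "length (interlace c ws) = length ws"
  by (induction ws arbitrary: c) auto

lemma reflect_snoc: "reflect (ws @ [a]) z = (- z, snd a) # reflect ws (fst a)"
  by (induction ws) auto

lemma reflect_swap_rev: "reflect (swap_rev ws) z = interlace z ws"
  by (induction ws arbitrary: z) (auto simp: reflect_snoc)

lemma head_x_swap_rev: "head_x (swap_rev ws) 0 = last_y ws"
  by (induction ws rule: rev_induct) auto

lemma interlace_translate:
  "interlace (c - y) (translate (x, y) ws) = translate (- y, x) (interlace c ws)"
  by (induction ws arbitrary: c) (auto simp: minus_prod_def)

lemma interlace_interlace:
  "interlace c (interlace d ws) = map uminus (butlast ((c, d) # ws))"
  by (induction ws arbitrary: c d) auto

lemma last_y_translate: "ws \<noteq> [] \<Longrightarrow> last_y (translate (x, y) ws) = last_y ws - y"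
  by (induction ws) auto

text \<open>A function of \<open>d + 1\<close> points depending only on their differences; push
  invariance is its invariance under cyclic rotation.\<close>

fun cyc :: "QB \<Rightarrow> (rat \<times> rat) list \<Rightarrow> rat" where
  "cyc \<psi> [] = 0"
| "cyc \<psi> (a # ws) = ev \<psi> (translate a ws) 0"

lemma cyc_translate: "cyc \<psi> (translate c ws) = cyc \<psi> ws"
  by (cases ws) (auto simp: comp_def)

text \<open>Recovers the points from the differences \<open>x_i - x_(i+1)\<close>. In these
  coordinates shuffling with a letter is plain insertion into a list.\<close>

fun suffix_sums :: "(rat \<times> rat) list \<Rightarrow> rat \<Rightarrow> (rat \<times> rat) list" where
  "suffix_sums [] z = []"
| "suffix_sums (a # ws) z = (fst a + head_x (suffix_sums ws z) z, snd a) # suffix_sums ws z"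

lemma suffix_sums_append:
  "suffix_sums (p @ q) z = suffix_sums p (head_x (suffix_sums q z) z) @ suffix_sums q z"
  by (induction p) auto

lemma suffix_sums_shift: "suffix_sums ws (z - t) = translate (t, 0) (suffix_sums ws z)"
proof (induction ws)
  case (Cons a ws)
  then show ?case by (simp add: head_x_translate prod_eq_iff)
qed simp

lemma translate_suffix_sums: "translate (0, y) (suffix_sums ws z) = suffix_sums (translate (0, y) ws) z"
proof (induction ws)
  case (Cons a ws)
  then show ?case
    using head_x_translate[of 0 y "suffix_sums ws z" z] by (simp add: prod_eq_iff)
qed simp

lemma uminus_suffix_sums: "map uminus (suffix_sums ws 0) = suffix_sums (map uminus ws) 0"
proof (induction ws)
  case (Cons a ws)
  have "head_x (map uminus vs) 0 = - head_x vs 0" for vs by (cases vs) auto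
  then show ?case by (simp add: Cons[symmetric] prod_eq_iff)
qed simp

lemma head_x_suffix_sums: "head_x (suffix_sums ws 0) 0 = sum_list (map fst ws)"
  by (induction ws) auto

lemma length_suffix_sums [simp]: "length (suffix_sums ws z) = length ws"
  by (induction ws) auto

lemma suffix_sums_surj: "\<exists>vs. suffix_sums vs z = ws"
proof (induction ws)
  case (Cons a ws)
  then obtain vs where vs: "suffix_sums vs z = ws" by blast
  have "suffix_sums ((fst a - head_x ws z, snd a) # vs) z = a # ws"
    by (simp add: vs)
  then show ?case by blast
qed (auto intro: exI[of _ "[]"])

lemma split_sum_suffix_sums:
  "split_sum f (suffix_sums ws z)
    = split_sum (\<lambda>p q. f (suffix_sums p (head_x (suffix_sums q z) z)) (suffix_sums q z)) ws"
proof (induction ws arbitrary: f)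
  case (Cons a ws)
  have "split_sum (\<lambda>p q. f ((fst a + head_x (suffix_sums ws z) z, snd a) # suffix_sums p (head_x (suffix_sums q z) z)) (suffix_sums q z)) ws
      = split_sum (\<lambda>p q. f (suffix_sums (a # p) (head_x (suffix_sums q z) z)) (suffix_sums q z)) ws"
    by (rule split_sum_cong) (auto simp: suffix_sums_append)
  with Cons show ?case by simp
qed simp

lemma Lie_B_suffix_sums_insert:
  assumes "\<psi> \<in> Lie_B" "ws \<noteq> []"
  shows "split_sum (\<lambda>p q. ev \<psi> (suffix_sums (p @ v # q) 0) 0) ws = 0"
proof -
  have "suffix_sums (p @ v # q) 0 = translate (- fst v, 0) (suffix_sums p (head_x (suffix_sums q 0) 0))
      @ (head_x (suffix_sums q 0) 0 - (- fst v), snd v) # suffix_sums q 0" for p q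
    using suffix_sums_shift[of p "head_x (suffix_sums q 0) 0" "- fst v"]
    by (simp add: suffix_sums_append add.commute)
  then have "split_sum (\<lambda>p q. ev \<psi> (suffix_sums (p @ v # q) 0) 0) ws
      = insert_sum \<psi> (- fst v) (snd v) (suffix_sums ws 0) 0"
    unfolding insert_sum_def split_sum_suffix_sums by simp
  moreover have "suffix_sums ws 0 \<noteq> []" using assms(2) by (cases ws) auto
  ultimately show ?thesis using Lie_B_insert_sum[OF assms(1)] by simp
qed

text \<open>Vanishing total puts the base point at x-coordinate 0, so only the y-coordinates get
  translated.\<close>

lemma cyc_suffix_sums:
  assumes "sum_list (map fst (a # ws)) = 0"
  shows "cyc \<psi> (suffix_sums (a # ws) 0) = ev \<psi> (suffix_sums (translate (0, snd a) ws) 0) 0"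
proof -
  have "fst a + head_x (suffix_sums ws 0) 0 = 0"
    using assms by (simp add: head_x_suffix_sums)
  then show ?thesis by (simp add: translate_suffix_sums)
qed

definition cyc_odd :: "QB \<Rightarrow> (rat \<times> rat) list \<Rightarrow> rat" where
  "cyc_odd \<psi> ws = cyc \<psi> ws - cyc \<psi> (map uminus ws)"

lemma cyc_odd_translate: "cyc_odd \<psi> (translate c ws) = cyc_odd \<psi> ws"
proof -
  have "map uminus (translate c ws) = translate (- c) (map uminus ws)" by (simp add: comp_def)
  then show ?thesis by (simp only: cyc_odd_def cyc_translate)
qed

text \<open>With the base point \<open>a\<close> fixed, this is the difference of two one-letter
  shuffle relations, one for the given points and one for their negatives.\<close>

lemma Lie_B_cyc_odd_insert:
  assumes \<psi>: "\<psi> \<in> Lie_B" and ws: "ws \<noteq> []"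
    and sum: "fst a + fst v + sum_list (map fst ws) = 0"
  shows "split_sum (\<lambda>p q. cyc_odd \<psi> (suffix_sums (a # p @ v # q) 0)) ws = 0"
proof -
  let ?T = "\<lambda>y ws. translate (0, y) ws"
  have "split_sum (\<lambda>p q. cyc_odd \<psi> (suffix_sums (a # p @ v # q) 0)) ws
      = split_sum (\<lambda>p q. ev \<psi> (suffix_sums (?T (snd a) p @ (v - (0, snd a)) # ?T (snd a) q) 0) 0
          - ev \<psi> (suffix_sums (map (\<lambda>w. - w - (0, - snd a)) p @ (- v - (0, - snd a)) # map (\<lambda>w. - w - (0, - snd a)) q) 0) 0) ws"
  proof (rule split_sum_cong)
    fix p q assume pq: "p @ q = ws"
    have s: "sum_list (map fst (a # p @ v # q)) = 0" using sum pq by auto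
    have "sum_list (map fst (map uminus vs)) = - sum_list (map fst vs)" for vs :: "(rat \<times> rat) list"
      by (induction vs) auto
    with s have s': "sum_list (map fst (- a # map uminus (p @ v # q))) = 0"
      by (metis list.simps(9) neg_equal_0_iff_equal)
    have "map uminus (suffix_sums (a # p @ v # q) 0) = suffix_sums (- a # map uminus (p @ v # q)) 0"
      by (simp only: uminus_suffix_sums list.map)
    then show "cyc_odd \<psi> (suffix_sums (a # p @ v # q) 0)
        = ev \<psi> (suffix_sums (?T (snd a) p @ (v - (0, snd a)) # ?T (snd a) q) 0) 0
          - ev \<psi> (suffix_sums (map (\<lambda>w. - w - (0, - snd a)) p @ (- v - (0, - snd a)) # map (\<lambda>w. - w - (0, - snd a)) q) 0) 0"
      unfolding cyc_odd_def
      by (simp only: cyc_suffix_sums[OF s] cyc_suffix_sums[OF s'])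
        (simp add: comp_def)
  qed
  also have "\<dots> = split_sum (\<lambda>p q. ev \<psi> (suffix_sums (p @ (v - (0, snd a)) # q) 0) 0) (?T (snd a) ws)
      - split_sum (\<lambda>p q. ev \<psi> (suffix_sums (p @ (- v - (0, - snd a)) # q) 0) 0) (map (\<lambda>w. - w - (0, - snd a)) ws)"
    by (simp only: split_sum_diff split_sum_map)
  also have "\<dots> = 0"
    using ws by (simp add: Lie_B_suffix_sums_insert[OF \<psi>])
  finally show ?thesis .
qed

context
  fixes \<psi> :: QB
  assumes Lie: "\<psi> \<in> Lie_B"
    and tau_inv: "\<And>ws. ev \<psi> (swap_rev ws) 0 = ev \<psi> ws 0"
begin

text \<open>The antipode relation at the points \<open>swap_rev ws\<close>, rewritten by
  \<open>tau_inv\<close>. Translation invariance then moves the final \<open>z\<close> to 0, which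
  produces the new base point.\<close>

lemma cyc_interlace:
  assumes "length us \<ge> 2"
  shows "cyc \<psi> (interlace (last_y us) us) = (-1) ^ length us * cyc \<psi> us"
proof -
  obtain x y ws where us: "us = (x, y) # ws" "ws \<noteq> []"
    using assms by (cases us; cases "tl us") auto
  let ?S = "interlace y ws"
  let ?L = "last_y ws"
  have S: "?S \<noteq> []" using us(2) by (cases ws) auto
  have "- ((-1) ^ length ws * ev \<psi> (translate (x, y) ws) 0)
      = ev \<psi> (interlace 0 (translate (x, y) ws)) (- last_y (translate (x, y) ws))"
    using Lie_B_ev_reflect[OF Lie, of "swap_rev (translate (x, y) ws)" 0]
    unfolding reflect_swap_rev head_x_swap_rev tau_inv by simp
  also have "\<dots> = ev \<psi> (translate (- y, x) ?S) (y - ?L)"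
    using interlace_translate[of y y x ws] us(2) by (simp add: last_y_translate)
  also have "\<dots> = ev \<psi> (translate (y - ?L, 0) (translate (- y, x) ?S)) 0"
    using Lie_B_ev_translate[OF Lie, of "translate (- y, x) ?S" "y - ?L" "y - ?L"] S by simp
  also have "\<dots> = ev \<psi> (translate (- ?L, x) ?S) 0"
    by (simp add: comp_def diff_diff_eq)
  finally show ?thesis using us by simp
qed

text \<open>Apply \<open>cyc_interlace\<close> twice; the two signs cancel.\<close>

lemma cyc_neg_rotate:
  assumes "vs \<noteq> []"
  shows "cyc \<psi> (map uminus (b # vs)) = cyc \<psi> (vs @ [b])"
proof -
  let ?us = "vs @ [b]"
  let ?vs = "interlace (snd b) ?us"
  have len: "length ?us \<ge> 2" using assms by (cases vs) auto
  \<comment> \<open>The last y-coordinate of \<open>?vs\<close> is \<open>fst b\<close>, so the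
    second application has this constant and \<open>interlace_interlace\<close> returns the negated
    list \<open>b # vs\<close>.\<close>
  have "interlace c (ws @ [b]) = interlace c ws @ [(- last_y ((0, c) # ws), fst b)]" for c ws
    by (induction ws arbitrary: c) auto
  then have last: "last_y ?vs = fst b" by simp
  have "cyc \<psi> (interlace (fst b) ?vs) = (-1) ^ length ?vs * cyc \<psi> ?vs"
    using cyc_interlace[of ?vs] len last by simp
  also have "cyc \<psi> ?vs = (-1) ^ length ?us * cyc \<psi> ?us"
    using cyc_interlace[OF len] by simp
  finally have "cyc \<psi> (interlace (fst b) ?vs) = cyc \<psi> ?us"
    by (simp add: mult.assoc[symmetric] power_add[symmetric])
  then show ?thesis
    unfolding interlace_interlace by (simp add: butlast_append)
qed

lemma cyc_odd_rotate:
  assumes "vs \<noteq> []"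
  shows "cyc_odd \<psi> (vs @ [b]) = - cyc_odd \<psi> (b # vs)"
proof -
  have "cyc \<psi> (map uminus (vs @ [b])) = cyc \<psi> (b # vs)"
    using cyc_neg_rotate[of "map uminus vs" "- b"] assms by (simp add: comp_def)
  then show ?thesis
    using cyc_neg_rotate[OF assms, of b] by (simp add: cyc_odd_def)
qed

text \<open>When the differences sum to zero, rotating them rotates the points up to a common
  translation.\<close>

lemma cyc_odd_suffix_sums_rotate:
  assumes "vs \<noteq> []" "sum_list (map fst (vs @ [b])) = 0"
  shows "cyc_odd \<psi> (suffix_sums (vs @ [b]) 0) = - cyc_odd \<psi> (suffix_sums (b # vs) 0)"
proof -
  have s: "fst b + head_x (suffix_sums vs 0) 0 = 0"
    using assms(2) by (simp add: head_x_suffix_sums add.commute)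
  have "suffix_sums vs (fst b) = translate (- fst b, 0) (suffix_sums vs 0)"
    using suffix_sums_shift[of vs 0 "- fst b"] by simp
  then have r: "b # suffix_sums vs (fst b) = translate (- fst b, 0) (suffix_sums (b # vs) 0)"
    using s by (simp add: prod_eq_iff)
  have "suffix_sums (vs @ [b]) 0 = suffix_sums vs (fst b) @ [b]"
    by (simp add: suffix_sums_append)
  moreover have "suffix_sums vs (fst b) \<noteq> []" using assms(1) by (cases vs) auto
  ultimately have "cyc_odd \<psi> (suffix_sums (vs @ [b]) 0) = - cyc_odd \<psi> (b # suffix_sums vs (fst b))"
    by (simp add: cyc_odd_rotate)
  then show ?thesis by (simp only: r cyc_odd_translate)
qed

text \<open>
  Shuffling \<open>v\<close> into the cyclic word once with base point \<open>a\<close> and once with base point \<open>b\<close> gives two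
  relations that differ, after rotation, only by the sign of one term.
\<close>

lemma cyc_odd_suffix_sums_eq_0:
  assumes sum: "sum_list (map fst (a # v # b # us)) = 0"
  shows "cyc_odd \<psi> (suffix_sums (a # v # b # us) 0) = 0"
proof -
  let ?H = "\<lambda>ws. cyc_odd \<psi> (suffix_sums ws 0)"
  have "split_sum (\<lambda>p q. ?H (a # p @ v # q)) (b # us) = 0"
    by (rule Lie_B_cyc_odd_insert[OF Lie]) (use sum in auto)
  then have 1: "?H (a # v # b # us) + split_sum (\<lambda>p q. ?H (a # b # p @ v # q)) us = 0"
    by (simp del: suffix_sums.simps)
  have "split_sum (\<lambda>p q. ?H (b # p @ v # q)) (us @ [a]) = 0"
    by (rule Lie_B_cyc_odd_insert[OF Lie]) (use sum in auto)
  then have "split_sum (\<lambda>p q. ?H ((b # p @ v # q) @ [a])) us + ?H ((b # us @ [a]) @ [v]) = 0"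
    by (simp add: split_sum_snoc del: suffix_sums.simps)
  moreover have "split_sum (\<lambda>p q. ?H ((b # p @ v # q) @ [a])) us
      = split_sum (\<lambda>p q. - ?H (a # b # p @ v # q)) us"
    by (rule split_sum_cong, rule cyc_odd_suffix_sums_rotate) (use sum in auto)
  \<comment> \<open>This term needs two rotations and keeps its sign; the others need one and change
    theirs.\<close>
  moreover have "?H ((b # us @ [a]) @ [v]) = - ?H (v # b # us @ [a])"
    by (rule cyc_odd_suffix_sums_rotate) (use sum in auto)
  moreover have "?H ((v # b # us) @ [a]) = - ?H (a # v # b # us)"
    by (rule cyc_odd_suffix_sums_rotate) (use sum in auto)
  ultimately have "?H (a # v # b # us) - split_sum (\<lambda>p q. ?H (a # b # p @ v # q)) us = 0"
    by (simp add: split_sum_uminus del: suffix_sums.simps)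
  with 1 show ?thesis by linarith
qed

lemma cyc_odd_eq_0:
  assumes "length us \<ge> 3"
  shows "cyc_odd \<psi> us = 0"
proof -
  \<comment> \<open>Translating the first point to x-coordinate 0 makes the differences sum to
    zero.\<close>
  obtain vs where vs: "suffix_sums vs 0 = translate (fst (hd us), 0) us"
    using suffix_sums_surj by blast
  have "length vs \<ge> 3" using arg_cong[OF vs, of length] assms by simp
  then obtain a v b ws where vs': "vs = a # v # b # ws"
    by (auto simp: numeral_3_eq_3 Suc_le_length_iff)
  have "head_x (suffix_sums vs 0) 0 = 0"
    unfolding vs using assms by (cases us) auto
  then have "sum_list (map fst vs) = 0" by (simp only: head_x_suffix_sums)
  then have "cyc_odd \<psi> (suffix_sums vs 0) = 0"
    unfolding vs' by (rule cyc_odd_suffix_sums_eq_0)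
  then show ?thesis unfolding vs cyc_odd_translate .
qed

lemma push_invariant:
  assumes even1: "\<And>a. ev \<psi> [- a] 0 = ev \<psi> [a] 0" and "u \<noteq> []"
  shows "ev \<psi> (translate (hd u) (tl u)) 0 = ev \<psi> (translate (last u) (butlast u)) 0"
proof -
  obtain vs b where u: "u = vs @ [b]" using \<open>u \<noteq> []\<close> by (metis rev_exhaust)
  have "cyc \<psi> (vs @ [b]) = cyc \<psi> (b # vs)"
  proof (cases "length vs \<ge> 2")
    case True
    then have "cyc_odd \<psi> (b # vs) = 0" by (intro cyc_odd_eq_0) simp
    moreover have "vs \<noteq> []" using True by auto
    ultimately show ?thesis
      using cyc_neg_rotate[of vs b] by (simp add: cyc_odd_def)
  next
    case False
    then consider "vs = []" | a where "vs = [a]" by (cases vs; cases "tl vs") auto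
    then show ?thesis
    proof cases
      case (2 a)
      then show ?thesis using even1[of "b - a"] by simp
    qed simp
  qed
  moreover have "cyc \<psi> u = ev \<psi> (translate (hd u) (tl u)) 0"
    using \<open>u \<noteq> []\<close> by (cases u) auto
  ultimately show ?thesis using u by simp
qed

end

section \<open>The commutator of \<open>\<sigma>\<^sub>\<psi>\<close> and \<open>\<tau>\<close>\<close>

lemma last_y_swap_rev: "last_y (swap_rev ws) = head_x ws 0"
  by (cases ws) auto

lemma translate_swap_rev: "translate c (swap_rev ws) = swap_rev (translate (prod.swap c) ws)"
  by (simp add: rev_map comp_def prod_eq_iff)

lemma split3_sum_swap_rev:
  "split3_sum f (swap_rev ws) = split3_sum (\<lambda>p u q. f (swap_rev q) (swap_rev u) (swap_rev p)) ws"
  by (simp add: split3_sum_rev split3_sum_map rev_map)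

text \<open>\<open>swap_rev\<close> exchanges \<open>head_x q 0\<close> with
  \<open>last_y p\<close>, so the first sum in \<open>ev_sigma\<close> is symmetric. In the second
  it moves the base point from the last to the first point of \<open>u\<close>, leaving the push
  defect.\<close>

lemma ev_sigma_swap_rev:
  assumes Lie: "\<psi> \<in> Lie_B" and b0: "Poly_Mapping.lookup \<psi> [0] = 0"
    and tau_inv: "\<And>ws. ev \<psi> (swap_rev ws) 0 = ev \<psi> ws 0" and x: "x \<in> QB0"
  shows "ev (sigma \<psi> x) (swap_rev ws) 0 = ev (sigma \<psi> (tau x)) ws 0
    + split3_sum (\<lambda>p u q. if u = [] then 0 else
        (ev \<psi> (translate (last u) (butlast u)) 0 - ev \<psi> (translate (hd u) (tl u)) 0)
        * ev (tau x) (p @ (fst (hd u), snd (last u)) # q) 0) ws"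
proof -
  \<comment> \<open>For the empty list both sides vanish by \<open>b0\<close>.\<close>
  have tr: "ev \<psi> ws t = ev \<psi> (translate (t, 0) ws) 0" for ws t
    using Lie_B_ev_Nil[OF Lie] b0 Lie_B_ev_translate[OF Lie, of ws t t] by (cases "ws = []") auto
  note sigma = ev_sigma[of \<psi> "\<lambda>ws. ev \<psi> ws 0", OF tr]
  have "split3_sum (\<lambda>p u q. ev \<psi> (translate (head_x q 0, last_y p) u) 0 * ev x (p @ q) 0) (swap_rev ws)
      = split3_sum (\<lambda>p u q. ev \<psi> (translate (head_x q 0, last_y p) u) 0 * ev (tau x) (p @ q) 0) ws"
    unfolding split3_sum_swap_rev
    by (rule split3_sum_cong)
      (simp only: translate_swap_rev head_x_swap_rev last_y_swap_rev tau_inv ev_tau[OF x] swap_simp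
        map_append rev_append)
  moreover have "split3_sum (\<lambda>p u q. if u = [] then 0 else
          ev \<psi> (translate (last u) (butlast u)) 0 * ev x (p @ (fst (hd u), snd (last u)) # q) 0) (swap_rev ws)
      = split3_sum (\<lambda>p u q. if u = [] then 0 else
          ev \<psi> (translate (hd u) (tl u)) 0 * ev (tau x) (p @ (fst (hd u), snd (last u)) # q) 0) ws"
    unfolding split3_sum_swap_rev
  proof (rule split3_sum_cong)
    fix p u q :: "(rat \<times> rat) list"
    show "(if swap_rev u = [] then 0 else
          ev \<psi> (translate (last (swap_rev u)) (butlast (swap_rev u))) 0
            * ev x (swap_rev q @ (fst (hd (swap_rev u)), snd (last (swap_rev u))) # swap_rev p) 0)
        = (if u = [] then 0 else
          ev \<psi> (translate (hd u) (tl u)) 0 * ev (tau x) (p @ (fst (hd u), snd (last u)) # q) 0)"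
    proof (cases u)
      case (Cons a v)
      have "butlast (swap_rev u) = swap_rev v" "last (swap_rev u) = prod.swap a"
        using Cons by (simp_all add: butlast_append)
      moreover have "hd (swap_rev u) = prod.swap (last u)"
        using Cons by (simp add: hd_rev last_map)
      moreover have "swap_rev q @ (snd (last u), fst a) # swap_rev p = swap_rev (p @ (fst a, snd (last u)) # q)"
        by simp
      moreover have "ev \<psi> (translate (prod.swap a) (swap_rev v)) 0 = ev \<psi> (translate a v) 0"
        by (simp only: translate_swap_rev swap_swap tau_inv)
      ultimately show ?thesis
        using Cons by (simp only: ev_tau[OF x]) (simp add: rev_map)
    qed simp
  qed
  moreover have "split3_sum (\<lambda>p u q. if u = [] then 0 else
        (ev \<psi> (translate (last u) (butlast u)) 0 - ev \<psi> (translate (hd u) (tl u)) 0)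
        * ev (tau x) (p @ (fst (hd u), snd (last u)) # q) 0) ws
      = split3_sum (\<lambda>p u q. if u = [] then 0 else
          ev \<psi> (translate (last u) (butlast u)) 0 * ev (tau x) (p @ (fst (hd u), snd (last u)) # q) 0) ws
      - split3_sum (\<lambda>p u q. if u = [] then 0 else
          ev \<psi> (translate (hd u) (tl u)) 0 * ev (tau x) (p @ (fst (hd u), snd (last u)) # q) 0) ws"
    unfolding split3_sum_minus[symmetric]
    by (rule split3_sum_cong) (simp add: left_diff_distrib)
  ultimately show ?thesis by (simp add: sigma)
qed

lemma tau_pi0_iff: "tau (pi0 \<psi>) = pi0 \<psi> \<longleftrightarrow> (\<forall>ws. ev \<psi> (swap_rev ws) 0 = ev \<psi> ws 0)"
proof -
  have "ev (tau (pi0 \<psi>)) ws 0 = ev \<psi> (swap_rev ws) 0" for ws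
    by (simp only: ev_tau[OF pi0_in] ev_pi0)
  then show ?thesis
    using QB0_eqI[OF tau_in_QB0 pi0_in] by (metis ev_pi0)
qed

lemma stab_tau_iff: "\<psi> \<in> stab_tau \<longleftrightarrow> \<psi> \<in> Lie_B \<and>
    (\<forall>x\<in>QB0. \<forall>ws. ev (sigma \<psi> (tau x)) ws 0 = ev (sigma \<psi> x) (swap_rev ws) 0)"
proof -
  have "sigma0 \<psi> (tau x) = tau (sigma0 \<psi> x)
      \<longleftrightarrow> (\<forall>ws. ev (sigma \<psi> (tau x)) ws 0 = ev (sigma \<psi> x) (swap_rev ws) 0)" if x: "x \<in> QB0" for x
  proof -
    have "ev (pi0 (sigma \<psi> (tau x))) ws 0 = ev (sigma \<psi> (tau x)) ws 0"
      "ev (tau (pi0 (sigma \<psi> x))) ws 0 = ev (sigma \<psi> x) (swap_rev ws) 0" for ws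
      by (simp_all only: ev_tau[OF pi0_in] ev_pi0)
    then show ?thesis
      unfolding sigma0_eq[OF x] sigma0_eq[OF tau_in_QB0]
      using QB0_eqI[OF pi0_in tau_in_QB0] by metis
  qed
  then show ?thesis unfolding stab_tau_def by blast
qed

section \<open>Parity in depth one\<close>

lemma weight_Cons [simp]: "weight (i # w) = (if i = 0 then 1 else i) + weight w"
  and weight_Nil [simp]: "weight [] = 0"
  by (simp_all add: weight_def)

lemma weight_append [simp]: "weight (u @ v) = weight u + weight v"
  by (induction u) auto

lemma weight_replicate_zero [simp]: "weight (replicate m 0) = m"
  by (induction m) auto

text \<open>A depth one word not ending in \<open>b_0\<close> is a monomial of degree one less than
  its weight; all other words vanish here.\<close>

lemma eval_word_neg_singleton: "eval_word w [- a] 0 = (-1) ^ Suc (weight w) * eval_word w [a] 0"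
proof (cases "(w = [] \<or> last w \<noteq> 0) \<and> depth w = 1")
  case True
  then obtain bs where bs: "w = block_word bs" "length bs = 1"
    using ex_block_word[of w] by (auto simp: depth_block_word)
  then obtain m n where "w = block_word [(m, n)]"
    by (cases bs) auto
  then show ?thesis
    by (simp add: eval_word_replicate_zero power_minus[of "fst a"] power_minus[of "snd a"] power_add)
next
  case False
  have "eval_word w [b] 0 = 0" for b
    using False eval_word_last_zero[of w "[b]"] eval_word_eq_0[of w "[b]" 0] by auto
  then show ?thesis by simp
qed

lemma ev_even_iff:
  "(\<forall>a. ev \<psi> [- a] 0 = ev \<psi> [a] 0) \<longleftrightarrow>
    (\<forall>m k. 1 \<le> k \<and> even (k + m) \<longrightarrow> Poly_Mapping.lookup \<psi> (replicate m 0 @ [k]) = 0)"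
proof (intro iffI allI impI)
  fix a
  assume L: "\<forall>m k. 1 \<le> k \<and> even (k + m) \<longrightarrow> Poly_Mapping.lookup \<psi> (replicate m 0 @ [k]) = 0"
  have "Poly_Mapping.lookup \<psi> w * eval_word w [- a] 0 = Poly_Mapping.lookup \<psi> w * eval_word w [a] 0" for w
  proof (cases "even (weight w) \<and> eval_word w [a] 0 \<noteq> 0")
    case True
    then have "w = [] \<or> last w \<noteq> 0" "depth w = 1"
      using eval_word_last_zero[of w "[a]"] eval_word_eq_0[of w "[a]" 0] by auto
    then obtain bs where bs: "w = block_word bs" "length bs = 1"
      using ex_block_word[of w] by (auto simp: depth_block_word)
    then obtain m n where w: "w = replicate m 0 @ [Suc n]"
      by (cases bs) auto
    with True have "even (Suc n + m)" by (simp add: add.commute)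
    with L have "Poly_Mapping.lookup \<psi> w = 0" unfolding w by (metis le_add1 plus_1_eq_Suc)
    then show ?thesis by simp
  next
    case False
    then show ?thesis by (auto simp: eval_word_neg_singleton)
  qed
  then show "ev \<psi> [- a] 0 = ev \<psi> [a] 0" by (simp only: ev_def)
next
  fix m k :: nat
  assume even: "\<forall>a. ev \<psi> [- a] 0 = ev \<psi> [a] 0" and mk: "1 \<le> k \<and> even (k + m)"
  \<comment> \<open>\<open>\<chi>\<close> takes at \<open>[a]\<close> the value of
    \<open>\<psi>\<close> at \<open>[- a]\<close>, and \<open>\<psi> - \<chi>\<close> doubles the
    coefficients of even weight.\<close>
  define \<chi> where "\<chi> = lin (\<lambda>w. scale ((-1) ^ Suc (weight w)) (mword w)) \<psi>"
  have ev\<chi>: "ev \<chi> [a] 0 = ev \<psi> [- a] 0" for a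
    unfolding \<chi>_def
    by (induction \<psi> rule: QB_induct) (simp_all only: lin_scale lin_mword ev_scale ev_mword lin_add ev_add eval_word_neg_singleton)
  have lookup\<chi>: "Poly_Mapping.lookup \<chi> w = (-1) ^ Suc (weight w) * Poly_Mapping.lookup \<psi> w" for w
    unfolding \<chi>_def
    by (induction \<psi> rule: QB_induct) (auto simp: lin_scale lin_add lookup_add lookup_mword distrib_left)
  let ?w = "replicate m 0 @ [k]"
  have "Poly_Mapping.lookup (\<psi> - \<chi>) ?w = 0"
  proof (rule lookup_eq_0_if_ev_eq_0[of 1])
    fix ws :: "(rat \<times> rat) list" assume "length ws = 1"
    then obtain a where "ws = [a]" by (auto simp: length_Suc_conv)
    then show "ev (\<psi> - \<chi>) ws 0 = 0" using even by (simp only: ev_minus ev\<chi>)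
  qed (use mk in auto)
  moreover have "even (weight ?w)" using mk by (simp add: add.commute)
  ultimately show "Poly_Mapping.lookup \<psi> ?w = 0"
    by (simp add: lookup_minus lookup\<chi>)
qed

lemma lq_iff: "\<psi> \<in> lq \<longleftrightarrow> \<psi> \<in> Lie_B \<and> Poly_Mapping.lookup \<psi> [0] = 0 \<and>
    (\<forall>ws. ev \<psi> (swap_rev ws) 0 = ev \<psi> ws 0) \<and> (\<forall>a. ev \<psi> [- a] 0 = ev \<psi> [a] 0)"
  unfolding lq_def ev_even_iff tau_pi0_iff Lie_B_eq_primitive primitive_def by blast

section \<open>The two inclusions and the element \<open>b_0\<close>\<close>

lemma lq_subset_stab_tau: "lq \<subseteq> stab_tau"
proof
  fix \<psi> assume "\<psi> \<in> lq"
  then have Lie: "\<psi> \<in> Lie_B" and b0: "Poly_Mapping.lookup \<psi> [0] = 0"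
    and tau_inv: "\<And>ws. ev \<psi> (swap_rev ws) 0 = ev \<psi> ws 0"
    and even1: "\<And>a. ev \<psi> [- a] 0 = ev \<psi> [a] 0"
    by (auto simp: lq_iff)
  have "ev (sigma \<psi> (tau x)) ws 0 = ev (sigma \<psi> x) (swap_rev ws) 0" if "x \<in> QB0" for x ws
  proof -
    have "split3_sum (\<lambda>p u q. if u = [] then 0 else
        (ev \<psi> (translate (last u) (butlast u)) 0 - ev \<psi> (translate (hd u) (tl u)) 0)
        * ev (tau x) (p @ (fst (hd u), snd (last u)) # q) 0) ws = split3_sum (\<lambda>p u q. 0) ws"
      using push_invariant[OF Lie tau_inv even1] by (intro split3_sum_cong) auto
    then show ?thesis
      using ev_sigma_swap_rev[OF Lie b0 tau_inv that, of ws] by (simp add: split3_sum_def)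
  qed
  with Lie show "\<psi> \<in> stab_tau" by (simp add: stab_tau_iff)
qed

lemma QB0_mword: "w = [] \<or> last w \<noteq> 0 \<Longrightarrow> mword w \<in> QB0"
  unfolding QB0_def by (intro QV.span_base) auto

lemma stab_tau_lq:
  assumes \<psi>: "\<psi> \<in> stab_tau" and b0: "Poly_Mapping.lookup \<psi> [0] = 0"
  shows "\<psi> \<in> lq"
proof -
  have Lie: "\<psi> \<in> Lie_B"
    and stab: "\<And>x ws. x \<in> QB0 \<Longrightarrow> ev (sigma \<psi> (tau x)) ws 0 = ev (sigma \<psi> x) (swap_rev ws) 0"
    using \<psi> by (auto simp: stab_tau_iff)
  \<comment> \<open>Hence \<open>\<sigma>\<close> sends the empty word to \<open>\<psi>\<close>, and
    commutation there is \<open>\<tau>\<close>-invariance.\<close>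
  have "partial \<psi> (mword []) = 0"
    by (simp add: partial_def derivation_of_def) (simp add: lin_def)
  then have "sigma \<psi> (mword []) = \<psi>" by (simp add: sigma_def mword_Nil)
  moreover have "tau (mword []) = mword []" by (simp add: tau_def)
  ultimately have tau_inv: "ev \<psi> (swap_rev ws) 0 = ev \<psi> ws 0" for ws
    using stab[OF QB0_mword, of "[]" ws] by simp
  have "ev \<psi> [- a] 0 = ev \<psi> [a] 0" for a
  proof -
    have 1: "letter 1 \<in> QB0" by (rule QB0_mword) simp
    have tau1: "tau (letter 1) = letter 1" by (simp add: tau_def)
    \<comment> \<open>\<open>letter 1\<close> is nonzero only at exactly one point, so only
      \<open>u = [0, a]\<close> survives and leaves the difference of the values at
      \<open>[- a]\<close> and \<open>[a]\<close>.\<close>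
    have "split3_sum (\<lambda>p u q. if u = [] then 0 else
        (ev \<psi> (translate (last u) (butlast u)) 0 - ev \<psi> (translate (hd u) (tl u)) 0)
        * ev (letter 1) (p @ (fst (hd u), snd (last u)) # q) 0) [0, a] = 0"
      using ev_sigma_swap_rev[OF Lie b0 tau_inv 1, of "[0, a]"] stab[OF 1, of "[0, a]"]
      unfolding tau1 by linarith
    then show ?thesis by (simp add: split3_sum_def)
  qed
  with Lie b0 tau_inv show ?thesis by (simp add: lq_iff)
qed

text \<open>Both sides are derivations with the same values on letters; for \<open>b_0\<close>
  itself both are zero.\<close>

lemma partial_letter_0: "partial (letter 0) x = x * letter 0 - letter 0 * x"
proof -
  have gen: "partial_gen [0] i = letter i * letter 0 - letter 0 * letter i" for i
    using partial_gen_replicate[of i 1] by (cases "i = 0") (simp_all add: partial_gen_def lie_bracket_def)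
  have "deriv_word (partial_gen [0]) w = mword w * letter 0 - letter 0 * mword w" for w
  proof (induction w)
    case (Cons i w)
    have "mword (i # w) = letter i * mword w" by (simp add: mword_mult)
    moreover have "deriv_word (partial_gen [0]) (i # w)
        = partial_gen [0] i * mword w + letter i * (mword w * letter 0 - letter 0 * mword w)"
      by (simp only: deriv_word.simps Cons)
    ultimately show ?case by (simp add: gen[of i] left_diff_distrib right_diff_distrib mult.assoc del: deriv_word.simps)
  qed (simp add: mword_Nil)
  then have "derivation_of (partial_gen [0]) x = x * letter 0 - letter 0 * x"
    unfolding derivation_of_def
    by (induction x rule: QB_induct)
      (simp_all add: lin_scale lin_add scale_mult_left scale_mult_right QV.scale_right_diff_distrib distrib_left distrib_right)
  then show ?thesis by (simp add: partial_def)
qed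

lemma letter_0_stab_tau: "letter 0 \<in> stab_tau"
proof -
  have "sigma (letter 0) x = x * letter 0" for x
    by (simp add: sigma_def partial_letter_0)
  then have "ev (sigma (letter 0) x) ws 0 = 0" for x ws
    by (metis ev_pi0 ev_zero pi0_mult_b0)
  then show ?thesis by (simp add: stab_tau_iff Lie_B.letter)
qed

lemma subspace_stab_tau: "QV.subspace stab_tau"
proof -
  have "partial (a + b) x = partial a x + partial b x" "partial (scale c a) x = scale c (partial a x)" for a b x c
    by (simp_all add: partial_def lin_add lin_scale)
  then have "sigma (a + b) x = sigma a x + sigma b x" "sigma (scale c a) x = scale c (sigma a x)" for a b x c
    by (simp_all add: sigma_def distrib_right scale_mult_left QV.scale_right_distrib)
  moreover have "sigma 0 x = 0" for x
    by (simp add: sigma_def partial_def)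
  ultimately show ?thesis
    unfolding QV.subspace_def
    by (auto simp: stab_tau_iff ev_add ev_scale intro: Lie_B.intros)
qed

lemma subspace_lq: "QV.subspace lq"
  unfolding QV.subspace_def
  by (auto simp: lq_iff ev_add ev_scale lookup_add intro: Lie_B.intros)

lemma stab_tau_eq: "stab_tau = {x + y | x y. x \<in> lq \<and> y \<in> QV.span {letter 0}}"
proof (intro equalityI subsetI)
  fix \<psi> assume \<psi>: "\<psi> \<in> stab_tau"
  let ?y = "scale (Poly_Mapping.lookup \<psi> [0]) (letter 0)"
  have "\<psi> - ?y \<in> stab_tau"
    using \<psi> letter_0_stab_tau subspace_stab_tau by (intro QV.subspace_diff QV.subspace_scale)
  then have "\<psi> - ?y \<in> lq"
    by (rule stab_tau_lq) (simp add: lookup_minus lookup_mword)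
  moreover have "?y \<in> QV.span {letter 0}" by (intro QV.span_scale QV.span_base) simp
  moreover have "\<psi> = (\<psi> - ?y) + ?y" by simp
  ultimately show "\<psi> \<in> {x + y | x y. x \<in> lq \<and> y \<in> QV.span {letter 0}}" by blast
next
  fix \<psi> assume "\<psi> \<in> {x + y | x y. x \<in> lq \<and> y \<in> QV.span {letter 0}}"
  moreover have "QV.span {letter 0} \<subseteq> stab_tau"
    using letter_0_stab_tau subspace_stab_tau by (intro QV.span_minimal) auto
  ultimately show "\<psi> \<in> stab_tau"
    using lq_subset_stab_tau QV.subspace_add[OF subspace_stab_tau] by blast
qed

section \<open>Bigrading\<close>

definition bidegree :: "nat list \<Rightarrow> nat \<times> nat" where
  "bidegree w = (weight w, depth w)"

definition component :: "nat \<times> nat \<Rightarrow> QB \<Rightarrow> QB" where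
  "component e = lin (\<lambda>w. if bidegree w = e then mword w else 0)"

lemma component_add: "component e (x + y) = component e x + component e y"
  and component_scale: "component e (scale c x) = scale c (component e x)"
  and component_zero: "component e 0 = 0"
  and component_diff: "component e (x - y) = component e x - component e y"
  and component_mword: "component e (mword w) = (if bidegree w = e then mword w else 0)"
  by (simp_all add: component_def lin_add lin_scale lin_minus)

lemma lookup_component:
  "Poly_Mapping.lookup (component e x) w = (if bidegree w = e then Poly_Mapping.lookup x w else 0)"
  by (induction x rule: QB_induct) (auto simp: component_add component_scale component_mword lookup_add lookup_mword)

lemma bidegree_append: "bidegree (u @ v) = bidegree u + bidegree v"
  by (simp add: bidegree_def)

text \<open>The box keeps \<open>a\<close> below \<open>(n, d)\<close>, so the truncated subtraction
  of pairs is exact.\<close>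

lemma component_mult_words:
  "(\<Sum>a\<in>{..n} \<times> {..d}. component a (mword u) * component ((n, d) - a) (mword v))
    = component (n, d) (mword (u @ v))"
proof -
  have "(\<Sum>a\<in>{..n} \<times> {..d}. component a (mword u) * component ((n, d) - a) (mword v))
      = (\<Sum>a\<in>{..n} \<times> {..d}. if a = bidegree u then (if bidegree v = (n, d) - a then mword (u @ v) else 0) else 0)"
    by (rule sum.cong) (auto simp: component_mword mword_mult)
  then show ?thesis
    by (auto simp: component_mword bidegree_append) (auto simp: bidegree_def)
qed

lemma component_mult:
  "component (n, d) (x * y) = (\<Sum>a\<in>{..n} \<times> {..d}. component a x * component ((n, d) - a) y)"
proof (induction x rule: QB_induct)
  case (scale c u)
  show ?case
  proof (induction y rule: QB_induct)
    case (scale c' v)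
    show ?case
      by (simp only: component_scale scale_mult_left scale_mult_right mword_mult
          QV.scale_sum_right[symmetric] component_mult_words)
  next
    case (add x y)
    then show ?case by (simp add: component_add distrib_left sum.distrib)
  qed
next
  case (add x y)
  then show ?case by (simp add: component_add distrib_right sum.distrib)
qed

text \<open>Indexed by the right factor, so that the expansions of \<open>x * y\<close> and
  \<open>y * x\<close> pair up into brackets of components.\<close>

lemma component_mult':
  "component (n, d) (x * y) = (\<Sum>a\<in>{..n} \<times> {..d}. component ((n, d) - a) x * component a y)"
  unfolding component_mult
  by (rule sum.reindex_bij_witness[where i = "\<lambda>a. (n, d) - a" and j = "\<lambda>a. (n, d) - a"]) auto

lemma Lie_B_sum: "(\<And>a. a \<in> A \<Longrightarrow> f a \<in> Lie_B) \<Longrightarrow> sum f A \<in> Lie_B"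
  by (induction A rule: infinite_finite_induct) (auto intro: Lie_B.intros)

lemma component_Lie_B: "\<psi> \<in> Lie_B \<Longrightarrow> component e \<psi> \<in> Lie_B"
proof (induction arbitrary: e rule: Lie_B.induct)
  case (bracket x y)
  obtain n d where e: "e = (n, d)" by (cases e)
  have "component e (lie_bracket x y)
      = (\<Sum>a\<in>{..n} \<times> {..d}. lie_bracket (component a x) (component ((n, d) - a) y))"
    unfolding lie_bracket_def component_diff e sum_subtractf
    by (simp only: component_mult[of n d x y] component_mult'[of n d y x])
  then show ?case by (simp only: Lie_B_sum Lie_B.bracket bracket.IH)
qed (auto simp: component_mword component_zero component_add component_scale intro: Lie_B.intros)

lemma sum_component: "x = (\<Sum>e\<in>bidegree ` Poly_Mapping.keys x. component e x)"
  by (rule poly_mapping_eqI) (auto simp: lookup_sum lookup_component in_keys_iff)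

lemma component_bihomogeneous: "component (n, d) x \<in> bihomogeneous n d"
  by (auto simp: bihomogeneous_def in_keys_iff lookup_component bidegree_def split: if_splits)

lemma bigraded_subspaceI:
  assumes V: "QV.subspace V" "V \<subseteq> Lie_B" and comp: "\<And>x e. x \<in> V \<Longrightarrow> component e x \<in> V"
  shows "bigraded_subspace V"
  unfolding bigraded_subspace_def
proof (intro conjI V equalityI subsetI)
  fix x assume x: "x \<in> V"
  have "component e x \<in> QV.span (\<Union>n. \<Union>d. V \<inter> bihomogeneous n d)" for e
    using comp[OF x, of e] component_bihomogeneous[of "fst e" "snd e" x] by (intro QV.span_base) auto
  then have "(\<Sum>e\<in>bidegree ` Poly_Mapping.keys x. component e x) \<in> QV.span (\<Union>n. \<Union>d. V \<inter> bihomogeneous n d)"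
    by (rule QV.span_sum)
  then show "x \<in> QV.span (\<Union>n. \<Union>d. V \<inter> bihomogeneous n d)"
    using sum_component[of x] by simp
next
  fix x assume "x \<in> QV.span (\<Union>n. \<Union>d. V \<inter> bihomogeneous n d)"
  moreover have "QV.span (\<Union>n. \<Union>d. V \<inter> bihomogeneous n d) \<subseteq> V"
    by (rule QV.span_minimal) (auto simp: V)
  ultimately show "x \<in> V" by blast
qed

lemma bidegree_tau_block_word: "bidegree (tau_word 0 (block_word bs)) = bidegree (block_word bs)"
proof (induction bs rule: block_word.induct)
  case (2 m n bs)
  have "tau_word 0 (block_word ((m, n) # bs)) = tau_word 0 (block_word bs) @ replicate n 0 @ [Suc m]"
    using tau_word_block[of "Suc n" 0 m "block_word bs"] by simp
  then show ?case using 2 by (simp add: bidegree_def)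
qed simp

text \<open>\<open>pi0\<close> comes first because \<open>tau_word\<close> drops a trailing run of
  \<open>b_0\<close> and then changes the weight.\<close>

lemma tau_pi0_component: "tau (pi0 (component e x)) = component e (tau (pi0 x))"
proof (induction x rule: QB_induct)
  case (scale c w)
  have "bidegree (tau_word 0 w) = bidegree w" if "w = [] \<or> last w \<noteq> 0"
    using ex_block_word[OF that] bidegree_tau_block_word by auto
  then show ?case
    by (auto simp: component_scale component_mword component_zero pi0_def tau_def lin_scale)
next
  case (add x y)
  then show ?case by (simp add: component_add pi0_def tau_def lin_add)
qed

lemma pi0_component: "pi0 (component e x) = component e (pi0 x)"
  by (induction x rule: QB_induct)
    (auto simp: component_scale component_mword component_zero component_add pi0_def lin_scale lin_add)

lemma component_lq: "\<psi> \<in> lq \<Longrightarrow> component e \<psi> \<in> lq"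
  using component_Lie_B[of \<psi> e] unfolding Lie_B_eq_primitive
  by (auto simp: lq_def primitive_def lookup_component tau_pi0_component) (simp add: pi0_component)

lemma component_span_letter_0: "x \<in> QV.span {letter 0} \<Longrightarrow> component e x \<in> QV.span {letter 0}"
  by (induction rule: QV.span_induct_alt)
    (auto simp: component_zero component_add component_scale component_mword
      intro: QV.span_zero QV.span_add QV.span_scale QV.span_base)

theorem theorem2p16:
  shows "bigraded_subspace stab_tau \<and>
    bigraded_subspace lq \<and>
    bigraded_subspace (QV.span {letter 0}) \<and>
    lq \<inter> QV.span {letter 0} = {0} \<and>
    stab_tau = {x + y | x y. x \<in> lq \<and> y \<in> QV.span {letter 0}}"
proof (intro conjI stab_tau_eq)
  show "bigraded_subspace lq"
    using subspace_lq component_lq by (intro bigraded_subspaceI) (auto simp: lq_iff)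
  show "bigraded_subspace (QV.span {letter 0})"
  proof (rule bigraded_subspaceI)
    show "QV.span {letter 0} \<subseteq> Lie_B" by (auto simp: QV.span_singleton intro: Lie_B.intros)
  qed (simp_all add: QV.subspace_span component_span_letter_0)
  show "bigraded_subspace stab_tau"
  proof (rule bigraded_subspaceI)
    show "QV.subspace stab_tau" by (rule subspace_stab_tau)
    show "stab_tau \<subseteq> Lie_B" by (auto simp: stab_tau_iff)
    \<comment> \<open>Stability under components is inherited from the two summands in
      \<open>stab_tau_eq\<close>.\<close>
    show "component e \<psi> \<in> stab_tau" if "\<psi> \<in> stab_tau" for \<psi> e
      using that component_lq component_span_letter_0 unfolding stab_tau_eq
      by (fastforce simp: component_add)
  qed
  show "lq \<inter> QV.span {letter 0} = {0}"
    using QV.subspace_0[OF subspace_lq]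
    by (auto simp: QV.span_singleton lq_iff lookup_mword QV.span_zero intro: image_eqI[of _ _ 0])
qed

end
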